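(* For each $p\in[0,1/2)$ there exists $\beta_1=\beta_1(p)=\frac{1-2p}{2-2p}\in(0,1/2]$ such that for all $\beta\in[0,\beta_1]$, any $\varepsilon>0$ and any $S_0\in\mathcal{D}\setminus\{\mathcal{D}_0\}$, $$\mathbb{E}_{\beta,p}[\tau^{1+\varepsilon}\mid \xi_0=S_0]=\infty .$$
   Context: Configurations: let $\mathcal{D}'\subset\{0,1\}^{\mathbb{Z}}$ be the set of configurations with finitely many $0$'s to the left of the origin and finitely many $1$'s to the right. Call $S,S'\in\mathcal{D}'$ equivalent if they are translates of each other, and let $\mathcal{D}$ be the (countable) set of equivalence classes. So each $S\in\mathcal{D}$ is an infinite string of $1$'s, followed by a finite string of $0$'s and $1$'s, followed by an infinite string of $0$'s, modulo translation. The ground state is $\mathcal{D}_0=\ldots 111000\ldots$ (up to translation). An unlike pair is a pair of adjacent sites with labels $01$ or $10$ (read left to right); each configuration has finitely many of them and at least one. Process: for $\beta,p\in[0,1]$ the discrete-time exclusion-voter process $\xi=(\xi_t)_{t\in\mathbb{Z}^+}$, $\mathbb{Z}^+=\{0,1,2,\ldots\}$, is the time-homogeneous Markov chain on $\mathcal{D}$ with the following one-step dynamics. At each time step, independently, a voter move is chosen with probability $\beta$ and an exclusion move with probability $1-\beta$; then one of the unlike pairs of the current configuration is chosen uniformly at random. In a voter move the chosen pair is replaced by $00$ or by $11$, each with probability $1/2$. In an exclusion move, a chosen pair $01$ becomes $10$ with probability $p$ (otherwise no change), and a chosen pair $10$ becomes $01$ with probability $1-p$ (otherwise no change). Its law and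 expectation are denoted $\mathbb{P}_{\beta,p}$, $\mathbb{E}_{\beta,p}$. Relaxation time: $\tau=\min\{t\in\mathbb{N}:\xi_t=\mathcal{D}_0\}$, $\mathbb{N}=\{1,2,\ldots\}$, with $\tau=+\infty$ if there is no such $t$. *)

theory Defs
  imports "HOL-Probability.Probability"
begin

section \<open>Configurations modulo translation\<close>

text \<open>The label 1 is \<^term>\<open>True\<close> and the label 0 is \<^term>\<open>False\<close>. The set below is \<open>\<D>'\<close>, and
  the type \<open>config\<close> is \<open>\<D>\<close>.\<close>

definition configs :: "(int \<Rightarrow> bool) set" where
  "configs = {S. finite {x. x < 0 \<and> \<not> S x} \<and> finite {x. x \<ge> 0 \<and> S x}}"

definition translates :: "(int \<Rightarrow> bool) \<Rightarrow> (int \<Rightarrow> bool) \<Rightarrow> bool" where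
  "translates S T \<longleftrightarrow> S \<in> configs \<and> T \<in> configs \<and> (\<exists>k. \<forall>x. T x = S (x + k))"

lemma heaviside_in_configs: "(\<lambda>x. x < 0) \<in> configs"
proof -
  have "{x::int. x < 0 \<and> \<not> x < 0} = {}" "{x::int. x \<ge> 0 \<and> x < 0} = {}" by auto
  then show ?thesis by (simp only: configs_def mem_Collect_eq finite.emptyI simp_thms)
qed

lemma part_equivp_translates: "part_equivp translates"
proof (rule part_equivpI)
  show "\<exists>S. translates S S"
    using heaviside_in_configs
    by (intro exI[of _ "\<lambda>x. x < 0"]) (auto simp: translates_def intro!: exI[of _ 0])
  show "symp translates"
  proof (rule sympI)
    fix S T assume "translates S T"
    then obtain k where k: "S \<in> configs" "T \<in> configs" "\<And>x. T x = S (x + k)"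
      by (auto simp: translates_def)
    have "\<forall>x. S x = T (x + - k)" using k(3) by simp
    then show "translates T S" using k(1,2) unfolding translates_def by blast
  qed
  show "transp translates"
  proof (rule transpI)
    fix S T U assume "translates S T" "translates T U"
    then obtain k l where k: "S \<in> configs" "U \<in> configs"
        "\<And>x. T x = S (x + k)" "\<And>x. U x = T (x + l)"
      by (auto simp: translates_def)
    have "\<forall>x. U x = S (x + (l + k))" using k(3,4) by (simp add: add.assoc)
    then show "translates S U" using k(1,2) unfolding translates_def by blast
  qed
qed

quotient_type config = "int \<Rightarrow> bool" / partial: translates
  by (rule part_equivp_translates)

lift_definition ground_state :: config is "\<lambda>x. x < 0"
  using heaviside_in_configs by (auto simp: translates_def intro!: exI[of _ 0])


section \<open>One step of the dynamics\<close>

text \<open>An unlike pair occupies the sites \<open>x\<close> and \<open>x + 1\<close>; it is identified with its left site.\<close>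

definition unlike_pairs :: "(int \<Rightarrow> bool) \<Rightarrow> int set" where
  "unlike_pairs S = {x. S x \<noteq> S (x + 1)}"

definition set_pair :: "(int \<Rightarrow> bool) \<Rightarrow> int \<Rightarrow> bool \<Rightarrow> bool \<Rightarrow> (int \<Rightarrow> bool)" where
  "set_pair S x a b = S(x := a, x + 1 := b)"

definition voter_move :: "(int \<Rightarrow> bool) \<Rightarrow> int \<Rightarrow> (int \<Rightarrow> bool) pmf" where
  "voter_move S x = do {
     b \<leftarrow> bernoulli_pmf (1 / 2);
     return_pmf (set_pair S x b b)
   }"

definition exclusion_move :: "real \<Rightarrow> (int \<Rightarrow> bool) \<Rightarrow> int \<Rightarrow> (int \<Rightarrow> bool) pmf" where
  "exclusion_move p S x =
     (if \<not> S x
      then do {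
        b \<leftarrow> bernoulli_pmf p;
        return_pmf (if b then set_pair S x True False else S)
      }
      else do {
        b \<leftarrow> bernoulli_pmf (1 - p);
        return_pmf (if b then set_pair S x False True else S)
      })"

definition raw_step :: "real \<Rightarrow> real \<Rightarrow> (int \<Rightarrow> bool) \<Rightarrow> (int \<Rightarrow> bool) pmf" where
  "raw_step \<beta> p S = do {
     voter \<leftarrow> bernoulli_pmf \<beta>;
     x \<leftarrow> pmf_of_set (unlike_pairs S);
     if voter then voter_move S x else exclusion_move p S x
   }"

text \<open>\<^const>\<open>pmf_of_set\<close> is meaningful only on finite nonempty sets.\<close>

lemma unlike_pairs_finite_nonempty:
  assumes "S \<in> configs"
  shows "finite (unlike_pairs S)" "unlike_pairs S \<noteq> {}"
proof -
  define A where "A = {x. x < 0 \<and> \<not> S x} \<union> {x. x \<ge> 0 \<and> S x}"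
  have fin: "finite A" using assms by (auto simp: configs_def A_def)
  have "unlike_pairs S \<subseteq> A \<union> (\<lambda>x. x - 1) ` A \<union> {-1}"
  proof
    fix x assume x: "x \<in> unlike_pairs S"
    have "x \<in> A \<or> x + 1 \<in> A \<or> x = -1"
      using x by (cases "x < -1"; cases "S x") (auto simp: unlike_pairs_def A_def)
    then show "x \<in> A \<union> (\<lambda>x. x - 1) ` A \<union> {-1}" by force
  qed
  then show "finite (unlike_pairs S)" by (rule finite_subset) (use fin in auto)
  show "unlike_pairs S \<noteq> {}"
  proof
    assume "unlike_pairs S = {}"
    then have eq: "S x = S (x + 1)" for x by (auto simp: unlike_pairs_def)
    have const: "S x = S 0" for x
    proof (induction x rule: int_induct[where k = 0])
      case base
      then show ?case by simp
    next
      case (step1 i)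
      then show ?case using eq[of i] by simp
    next
      case (step2 i)
      then show ?case using eq[of "i - 1"] by simp
    qed
    have "infinite {x::int. x < 0}" "infinite {x::int. x \<ge> 0}"
      using infinite_Iio[of "0::int"] infinite_Ici[of "0::int"]
      by (simp_all add: lessThan_def atLeast_def)
    then show False using assms const by (cases "S 0") (auto simp: configs_def)
  qed
qed

lemma set_pair_in_configs:
  assumes "S \<in> configs"
  shows "set_pair S x a b \<in> configs"
proof -
  have "finite ({y. y < 0 \<and> \<not> S y} \<union> {x, x + 1})" "finite ({y. y \<ge> 0 \<and> S y} \<union> {x, x + 1})"
    using assms by (auto simp: configs_def)
  moreover have "{y. y < 0 \<and> \<not> set_pair S x a b y} \<subseteq> {y. y < 0 \<and> \<not> S y} \<union> {x, x + 1}"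
    "{y. y \<ge> 0 \<and> set_pair S x a b y} \<subseteq> {y. y \<ge> 0 \<and> S y} \<union> {x, x + 1}"
    by (auto simp: set_pair_def)
  ultimately have "finite {y. y < 0 \<and> \<not> set_pair S x a b y}"
    "finite {y. y \<ge> 0 \<and> set_pair S x a b y}"
    using finite_subset by blast+
  then show ?thesis by (simp add: configs_def)
qed

lemma raw_step_in_configs:
  assumes "S \<in> configs" "T \<in> set_pmf (raw_step \<beta> p S)"
  shows "T \<in> configs"
  using assms
  by (auto simp: raw_step_def voter_move_def exclusion_move_def set_pair_in_configs split: if_splits)

lemma raw_step_translate:
  fixes S :: "int \<Rightarrow> bool" and k :: int
  defines "tr \<equiv> (\<lambda>(S :: int \<Rightarrow> bool) x. S (x + k))"
  assumes "S \<in> configs"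
  shows "raw_step \<beta> p (tr S) = map_pmf tr (raw_step \<beta> p S)"
proof -
  have pair: "set_pair (tr S) (x - k) a b = tr (set_pair S x a b)" for x a b
    by (auto simp: set_pair_def tr_def fun_eq_iff)
  have "unlike_pairs (tr S) = (\<lambda>x. x - k) ` unlike_pairs S"
    by (force simp: unlike_pairs_def tr_def image_iff algebra_simps)
  then have "pmf_of_set (unlike_pairs (tr S))
      = map_pmf (\<lambda>x. x - k) (pmf_of_set (unlike_pairs S))"
    using unlike_pairs_finite_nonempty[OF assms(2)] by (subst map_pmf_of_set_inj) auto
  moreover have "voter_move (tr S) (x - k) = map_pmf tr (voter_move S x)" for x
    by (simp add: voter_move_def pair map_bind_pmf)
  moreover have "exclusion_move p (tr S) (x - k) = map_pmf tr (exclusion_move p S x)" for x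
  proof -
    have "tr S (x - k) = S x" by (simp add: tr_def)
    then show ?thesis
      by (auto simp: exclusion_move_def pair map_bind_pmf intro!: bind_pmf_cong)
  qed
  ultimately show ?thesis
    by (auto simp: raw_step_def map_bind_pmf bind_map_pmf intro!: bind_pmf_cong)
qed

lift_definition step :: "real \<Rightarrow> real \<Rightarrow> config \<Rightarrow> config pmf"
  is "\<lambda>\<beta> p S. map_pmf abs_config (raw_step \<beta> p S)"
proof -
  fix \<beta> p :: real and S T
  assume "translates S T"
  then obtain k where ST: "S \<in> configs" "T = (\<lambda>x. S (x + k))"
    by (auto simp: translates_def fun_eq_iff)
  have "abs_config (\<lambda>x. U (x + k)) = abs_config U" if "U \<in> set_pmf (raw_step \<beta> p S)" for U
  proof -
    have "(\<lambda>x. U (x + k)) \<in> set_pmf (raw_step \<beta> p T)"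
      unfolding ST(2) raw_step_translate[OF ST(1)] using that by auto
    then have "translates U (\<lambda>x. U (x + k))"
      using raw_step_in_configs that ST(1) \<open>translates S T\<close> by (auto simp: translates_def)
    then show ?thesis using Quotient3_rel[OF Quotient3_config] by metis
  qed
  then show "map_pmf abs_config (raw_step \<beta> p S) = map_pmf abs_config (raw_step \<beta> p T)"
    unfolding ST(2) raw_step_translate[OF ST(1)]
    by (auto simp: pmf.map_comp intro!: map_pmf_cong)
qed


section \<open>The process and its relaxation time\<close>

text \<open>A process realised on a probability space \<open>M\<close>, with arbitrary initial law.\<close>

definition markov_chain ::
  "('s \<Rightarrow> 's pmf) \<Rightarrow> 'w measure \<Rightarrow> (nat \<Rightarrow> 'w \<Rightarrow> 's) \<Rightarrow> bool" where
  "markov_chain K M \<xi> \<longleftrightarrow>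
     prob_space M \<and>
     (\<forall>t. \<xi> t \<in> measurable M (count_space UNIV)) \<and>
     (\<forall>t x y. \<P>(\<omega> in M. \<forall>i\<le>t. \<xi> i \<omega> = x i) > 0 \<longrightarrow>
        \<P>(\<omega> in M. \<xi> (Suc t) \<omega> = y \<bar> \<forall>i\<le>t. \<xi> i \<omega> = x i) = pmf (K (x t)) y)"

definition exclusion_voter_process ::
  "real \<Rightarrow> real \<Rightarrow> 'w measure \<Rightarrow> (nat \<Rightarrow> 'w \<Rightarrow> config) \<Rightarrow> bool" where
  "exclusion_voter_process \<beta> p M \<xi> \<longleftrightarrow> markov_chain (step \<beta> p) M \<xi>"

text \<open>Note that \<open>\<tau> \<ge> 1\<close>, and that \<^term>\<open>Inf {} = (\<infinity> :: enat)\<close>.\<close>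

definition relaxation_time :: "(nat \<Rightarrow> config) \<Rightarrow> enat" where
  "relaxation_time X = Inf {enat t |t. 1 \<le> t \<and> X t = ground_state}"

definition enat_powr :: "enat \<Rightarrow> real \<Rightarrow> ennreal" where
  "enat_powr n a = (case n of enat m \<Rightarrow> ennreal (real m powr a) | \<infinity> \<Rightarrow> \<infinity>)"

definition cond_nn_expectation :: "'w measure \<Rightarrow> ('w \<Rightarrow> ennreal) \<Rightarrow> ('w \<Rightarrow> bool) \<Rightarrow> ennreal" where
  "cond_nn_expectation M f Q = (\<integral>\<^sup>+ \<omega>. f \<omega> \<partial>uniform_measure M {\<omega> \<in> space M. Q \<omega>})"

end

theory Submission
  imports Defs
begin

text \<open>
  Let \<open>f\<close> be the number of inversions, the pairs of a 0 and a 1 further to the right. It vanishes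
  only at the ground state. For \<open>\<beta> \<le> (1 - 2p) / (2 - 2p)\<close> it is a submartingale
  (\<open>inversions_submartingale\<close>): an exclusion move changes \<open>f\<close> by \<open>\<plusminus>1\<close>, a voter move has mean effect
  \<open>-1\<close> on a pair 01 and \<open>0\<close> on a pair 10, and there are more pairs 10 than 01. Hence the
  expectation of \<open>f\<close> at time \<open>t\<close> on the event \<open>\<tau> > t\<close> stays at least 1 when started off the ground
  state, since stopping at the ground state loses nothing.

  If \<open>\<tau>\<close> had a finite moment of order \<open>1 + \<epsilon>\<close>, then \<open>\<tau> > t\<close> would have probability of order
  at most \<open>t\<close> to the power \<open>-1 - \<epsilon>\<close>. This contradicts the lower bound as soon as \<open>f\<close> is, up to an
  event of negligible contribution, at most \<open>t\<close> to the power \<open>1 + \<epsilon> / 2\<close> at time \<open>t\<close>. So it suffices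
  that the \<open>q\<close>-th moment of \<open>f\<close> at time \<open>t\<close> is at most of order \<open>t ^ q\<close> for every \<open>q\<close>
  (\<open>inversion_number_moment\<close>).

  For \<open>\<beta> = 0\<close> this is immediate, because \<open>f\<close> grows by at most 1 per step. For \<open>\<beta> > 0\<close> a voter
  move may change \<open>f\<close> by as much as the width of the configuration, and the width could a priori
  grow linearly: a few particles running ahead of the others. Such runners are killed by the noise
  of the voter moves, and the following functional detects this. Fix the origin, let a
  site be misplaced if it differs from the ground state at the origin, let \<open>w\<close> denote the distance to
  the origin and let \<open>U\<close> be the sum of \<open>w ^ k\<close> over the misplaced sites. At a pair at distance \<open>w\<close>,
  the mean increment of \<open>U\<close> is at most of order \<open>w ^ (k - 1)\<close>, while a voter move changes \<open>U\<close> by at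
  least \<open>w ^ k\<close> in absolute value. For the concave function \<open>sqrt (1 + U)\<close> the second-order loss
  beats the drift unless \<open>w ^ (k + 1)\<close> is at most of order \<open>1 + U\<close>. With \<open>k = 4q - 1\<close> the
  mean increment of \<open>sqrt (1 + U)\<close> is therefore bounded by a constant times its power \<open>1 - 1/q\<close>, and
  its mean at time \<open>t\<close> is at most of order \<open>t ^ q\<close> (\<open>displacement_one_step\<close>). Finally \<open>f ^ q\<close>
  is at most a constant times \<open>sqrt (1 + U)\<close> (\<open>card_inversions_power_le\<close>), because distinct misplaced
  sites on one side of the origin lie at distinct distances.
\<close>

section \<open>Inversions\<close>

lemma configs_obtain_bounds:
  assumes "S \<in> configs"
  obtains n :: int where "n > 0" "\<And>x. x < -n \<Longrightarrow> S x" "\<And>x. x \<ge> n \<Longrightarrow> \<not> S x"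
proof -
  have "finite ({x. x < 0 \<and> \<not> S x} \<union> {x. x \<ge> 0 \<and> S x})"
    using assms by (simp add: configs_def)
  then have "finite (abs ` ({x. x < 0 \<and> \<not> S x} \<union> {x. x \<ge> 0 \<and> S x}))" (is "finite ?A") by simp
  then obtain n where n: "\<And>a. a \<in> ?A \<Longrightarrow> a \<le> n"
    by (meson bdd_above_finite bdd_above.unfold)
  show ?thesis
  proof (rule that[of "max 1 (n + 1)"])
    show "S x" if "x < - max 1 (n + 1)" for x
    proof (rule ccontr)
      assume "\<not> S x"
      with that have "\<bar>x\<bar> \<in> ?A" by (intro imageI) auto
      from n[OF this] that show False by linarith
    qed
    show "\<not> S x" if "x \<ge> max 1 (n + 1)" for x
    proof
      assume "S x"
      with that have "\<bar>x\<bar> \<in> ?A" by (intro imageI) auto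
      from n[OF this] that show False by linarith
    qed
  qed simp
qed

definition inversions :: "(int \<Rightarrow> bool) \<Rightarrow> (int \<times> int) set" where
  "inversions S = {(x, y). x < y \<and> \<not> S x \<and> S y}"

lemma finite_zeros_left:
  assumes "S \<in> configs" shows "finite {z. z < x \<and> \<not> S z}"
proof -
  from configs_obtain_bounds[OF assms] obtain n where "\<And>x. x < -n \<Longrightarrow> S x" by metis
  then have "{z. z < x \<and> \<not> S z} \<subseteq> {-n..x}" by force
  then show ?thesis using finite_subset by blast
qed

lemma finite_ones_right:
  assumes "S \<in> configs" shows "finite {y. y > x \<and> S y}"
proof -
  from configs_obtain_bounds[OF assms] obtain n where n: "\<And>x. x \<ge> n \<Longrightarrow> \<not> S x" by metis
  have "{y. y > x \<and> S y} \<subseteq> {x..n}"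
  proof
    fix y assume "y \<in> {y. y > x \<and> S y}"
    then show "y \<in> {x..n}" using n[of y] by (cases "y \<ge> n") auto
  qed
  then show ?thesis using finite_subset by blast
qed

lemma finite_inversions:
  assumes "S \<in> configs" shows "finite (inversions S)"
proof -
  from configs_obtain_bounds[OF assms] obtain n
    where n: "\<And>x. x < -n \<Longrightarrow> S x" "\<And>x. x \<ge> n \<Longrightarrow> \<not> S x" by metis
  have "inversions S \<subseteq> {-n..n} \<times> {-n..n}"
  proof
    fix u assume "u \<in> inversions S"
    then obtain x y where u: "u = (x, y)" "x < y" "\<not> S x" "S y" by (auto simp: inversions_def)
    then have "\<not> x < -n" "\<not> y \<ge> n" using n by blast+
    then show "u \<in> {-n..n} \<times> {-n..n}" using u by auto
  qed
  then show ?thesis by (rule finite_subset) simp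
qed

text \<open>Changing the labels of the sites \<open>x\<close> and \<open>x + 1\<close> only matters through three counts: the inversions
  \<open>r\<close> avoiding both sites, the zeros \<open>zl\<close> to their left and the ones \<open>ro\<close> to their right. All changes
  of the number of inversions in one step can be read off from this formula: \<open>zl\<close> and \<open>ro\<close> cancel
  on average in a voter move and exactly in an exclusion move.\<close>

lemma card_inversions_set_pair:
  assumes "S \<in> configs"
  obtains r :: nat and zl :: nat and ro :: nat where
    "\<And>a b. card (inversions (set_pair S x a b)) =
       r + (of_bool (\<not> a) + of_bool (\<not> b)) * ro + (of_bool a + of_bool b) * zl + of_bool (\<not> a \<and> b)"
proof -
  define Z where "Z = {z. z < x \<and> \<not> S z}"
  define R where "R = {y. y > x + 1 \<and> S y}"
  define I where "I = {(u, v). (u, v) \<in> inversions S \<and> u \<notin> {x, x + 1} \<and> v \<notin> {x, x + 1}}"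
  have fin: "finite Z" "finite R" "finite I"
    using finite_zeros_left[OF assms] finite_ones_right[OF assms] finite_inversions[OF assms]
    by (auto simp: Z_def R_def I_def intro: finite_subset[of _ "inversions S"])
  have dec: "inversions (set_pair S x a b) = I \<union>
      (((if a then {} else {x}) \<union> (if b then {} else {x + 1})) \<times> R \<union>
       (Z \<times> ((if a then {x} else {}) \<union> (if b then {x + 1} else {})) \<union>
       (if \<not> a \<and> b then {(x, x + 1)} else {})))" for a b
    by (auto simp: inversions_def set_pair_def I_def Z_def R_def split: if_splits)
  have "card (inversions (set_pair S x a b)) =
      card I + (card ((if a then {} else {x}) \<union> (if b then {} else {x + 1})) * card R +
       (card Z * card ((if a then {x} else {}) \<union> (if b then {x + 1} else {})) +
       card (if \<not> a \<and> b then {(x, x + 1)} else {})))" for a b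
    unfolding dec using fin
    by (subst card_Un_disjoint, simp, simp, force simp: I_def Z_def R_def split: if_splits)+
      (simp add: card_cartesian_product)
  then show ?thesis
    by (intro that[of "card I" "card R" "card Z"]) auto
qed

lemma set_pair_same: "set_pair S x (S x) (S (x + 1)) = S"
  by (auto simp: set_pair_def)

text \<open>Reading from left to right, the labels start at 1 and end at 0, so the descents 10 outnumber the
  ascents 01 by one; this is the telescoping sum of \<open>S x - S (x + 1)\<close>.\<close>

lemma card_01_le_card_10:
  assumes "S \<in> configs"
  shows "card {x \<in> unlike_pairs S. \<not> S x} \<le> card {x \<in> unlike_pairs S. S x}"
proof -
  from configs_obtain_bounds[OF assms] obtain n
    where n: "n > 0" "\<And>x. x < -n \<Longrightarrow> S x" "\<And>x. x \<ge> n \<Longrightarrow> \<not> S x" by metis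
  define g where "g x = (of_bool (S x) :: int)" for x
  have tele: "(\<Sum>i<m. g (-n - 1 + int i) - g (-n - 1 + int i + 1)) = g (-n - 1) - g (-n - 1 + int m)"
    for m by (induction m) (auto simp: algebra_simps)
  \<comment> \<open>the window from \<open>-n - 1\<close> to \<open>n\<close> starts with a 1 and ends with a 0\<close>
  define m where "m = nat (2 * n + 1)"
  have "(\<Sum>x\<in>{-n - 1..<n}. g x - g (x + 1)) = (\<Sum>i<m. g (-n - 1 + int i) - g (-n - 1 + int i + 1))"
    by (rule sum.reindex_bij_witness[of _ "\<lambda>i. -n - 1 + int i" "\<lambda>x. nat (x + n + 1)"])
      (use n in \<open>auto simp: m_def\<close>)
  also have "\<dots> = 1"
    unfolding tele using n by (simp add: g_def m_def)
  finally have s: "(\<Sum>x\<in>{-n - 1..<n}. g x - g (x + 1)) = 1" .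
  have sub: "unlike_pairs S \<subseteq> {-n - 1..<n}"
  proof
    fix x assume "x \<in> unlike_pairs S"
    then have "S x \<noteq> S (x + 1)" by (simp add: unlike_pairs_def)
    with n(2)[of x] n(2)[of "x + 1"] n(3)[of x] n(3)[of "x + 1"] show "x \<in> {-n - 1..<n}" by force
  qed
  have fin: "finite (unlike_pairs S)" using unlike_pairs_finite_nonempty[OF assms] by simp
  have "(\<Sum>x\<in>{-n - 1..<n}. g x - g (x + 1)) = (\<Sum>x\<in>unlike_pairs S. g x - g (x + 1))"
    using sub by (intro sum.mono_neutral_right) (auto simp: unlike_pairs_def g_def)
  also have "\<dots> = (\<Sum>x\<in>unlike_pairs S. of_bool (S x) - of_bool (\<not> S x))"
    by (intro sum.cong) (auto simp: unlike_pairs_def g_def)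
  also have "\<dots> = int (card {x \<in> unlike_pairs S. S x}) - int (card {x \<in> unlike_pairs S. \<not> S x})"
    using fin by (simp add: sum_subtractf Int_def)
  finally show ?thesis using s by linarith
qed

section \<open>Expectations after one step\<close>

lemma finite_set_pmf_raw_step:
  assumes "S \<in> configs" shows "finite (set_pmf (raw_step \<beta> p S))"
  using unlike_pairs_finite_nonempty[OF assms]
  by (auto simp: raw_step_def voter_move_def exclusion_move_def)

lemma expectation_raw_step:
  fixes h :: "(int \<Rightarrow> bool) \<Rightarrow> real"
  assumes S: "S \<in> configs" and \<beta>: "0 \<le> \<beta>" "\<beta> \<le> 1" and p: "0 \<le> p" "p \<le> 1"
  shows "measure_pmf.expectation (raw_step \<beta> p S) h =
    (\<Sum>x\<in>unlike_pairs S.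
        \<beta> * ((h (set_pair S x True True) + h (set_pair S x False False)) / 2) +
        (1 - \<beta>) * (if S x then (1 - p) * h (set_pair S x False True) + p * h S
                   else p * h (set_pair S x True False) + (1 - p) * h S))
      / card (unlike_pairs S)"
proof -
  note un = unlike_pairs_finite_nonempty[OF S]
  have fv: "finite (set_pmf (voter_move S x))" "finite (set_pmf (exclusion_move p S x))" for x
    by (auto simp: voter_move_def exclusion_move_def)
  have bern: "measure_pmf.expectation (bernoulli_pmf r \<bind> (\<lambda>b. return_pmf (g b))) h
      = r * h (g True) + (1 - r) * h (g False)"
    if "0 \<le> r" "r \<le> 1" for r :: real and g :: "bool \<Rightarrow> int \<Rightarrow> bool"
    using that by (subst pmf_expectation_bind[of UNIV]) (auto simp: UNIV_bool)
  have v: "measure_pmf.expectation (voter_move S x) h =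
      (h (set_pair S x True True) + h (set_pair S x False False)) / 2" for x
    unfolding voter_move_def by (simp add: bern)
  have e: "measure_pmf.expectation (exclusion_move p S x) h =
      (if S x then (1 - p) * h (set_pair S x False True) + p * h S
       else p * h (set_pair S x True False) + (1 - p) * h S)" for x
    unfolding exclusion_move_def using p by (simp add: bern)
  have in1: "measure_pmf.expectation
       (pmf_of_set (unlike_pairs S) \<bind> (\<lambda>x. if b then voter_move S x else exclusion_move p S x)) h
     = (\<Sum>x\<in>unlike_pairs S. (if b then measure_pmf.expectation (voter_move S x) h
          else measure_pmf.expectation (exclusion_move p S x) h)) / card (unlike_pairs S)" for b
    using un fv
    by (cases b; subst pmf_expectation_bind[of "unlike_pairs S"]) (simp_all add: sum_divide_distrib)
  have "measure_pmf.expectation (raw_step \<beta> p S) h =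
    (\<Sum>b\<in>UNIV. pmf (bernoulli_pmf \<beta>) b *\<^sub>R measure_pmf.expectation
       (pmf_of_set (unlike_pairs S) \<bind> (\<lambda>x. if b then voter_move S x else exclusion_move p S x)) h)"
    unfolding raw_step_def using un fv by (subst pmf_expectation_bind[of UNIV]) auto
  also have "\<dots> = \<beta> * ((\<Sum>x\<in>unlike_pairs S. measure_pmf.expectation (voter_move S x) h) / card (unlike_pairs S))
     + (1 - \<beta>) * ((\<Sum>x\<in>unlike_pairs S. measure_pmf.expectation (exclusion_move p S x) h) / card (unlike_pairs S))"
    using \<beta> by (simp add: in1 UNIV_bool)
  also have "\<dots> = (\<Sum>x\<in>unlike_pairs S. \<beta> * measure_pmf.expectation (voter_move S x) h +
      (1 - \<beta>) * measure_pmf.expectation (exclusion_move p S x) h) / card (unlike_pairs S)"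
    by (simp add: sum.distrib sum_distrib_left add_divide_distrib)
  finally show ?thesis unfolding v e .
qed

text \<open>Each pair 01 contributes \<open>- \<beta> - (1 - \<beta>) p\<close> to the drift and each pair 10 contributes
  \<open>(1 - \<beta>) (1 - p)\<close>. Matching every 01 with a 10 leaves \<open>(1 - \<beta>) (1 - 2 p) - \<beta>\<close> per match, and
  the bound on \<open>\<beta>\<close> says exactly that this is nonnegative.\<close>

lemma inversions_submartingale:
  assumes S: "S \<in> configs" and p: "0 \<le> p" "p < 1 / 2"
    and \<beta>: "0 \<le> \<beta>" "\<beta> \<le> (1 - 2 * p) / (2 - 2 * p)"
  shows "measure_pmf.expectation (raw_step \<beta> p S) (\<lambda>S. real (card (inversions S)))
     \<ge> card (inversions S)"
proof -
  note un = unlike_pairs_finite_nonempty[OF S]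
  have b: "\<beta> * (2 - 2 * p) \<le> 1 - 2 * p" using \<beta> p by (simp add: field_simps)
  have b1: "\<beta> \<le> 1" 
  proof -
    have "(1 - 2 * p) / (2 - 2 * p) \<le> 1" using p by (simp add: field_simps)
    then show ?thesis using \<beta> by linarith
  qed
  define f where "f S = real (card (inversions S))" for S
  \<comment> \<open>with \<open>f S\<close> itself split off, only the drift of the pair remains\<close>
  have pair_term: "\<beta> * ((f (set_pair S x True True) + f (set_pair S x False False)) / 2) +
        (1 - \<beta>) * (if S x then (1 - p) * f (set_pair S x False True) + p * f S
                   else p * f (set_pair S x True False) + (1 - p) * f S)
      = f S + (if S x then (1 - \<beta>) * (1 - p) else - \<beta> - (1 - \<beta>) * p)"
    if "x \<in> unlike_pairs S" for x
  proof -
    have ne: "S x \<noteq> S (x + 1)" using that by (simp add: unlike_pairs_def)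
    obtain r zl ro :: nat where *: "\<And>a b. card (inversions (set_pair S x a b)) =
       r + (of_bool (\<not> a) + of_bool (\<not> b)) * ro + (of_bool a + of_bool b) * zl + of_bool (\<not> a \<and> b)"
      using card_inversions_set_pair[OF S] by metis
    have fS: "f S = f (set_pair S x (S x) (S (x + 1)))" by (simp only: set_pair_same)
    show ?thesis unfolding fS using ne by (cases "S x") (auto simp: f_def * field_simps)
  qed
  let ?A = "{x \<in> unlike_pairs S. S x}" and ?B = "{x \<in> unlike_pairs S. \<not> S x}"
  have "0 \<le> real (card ?B) * ((1 - \<beta>) * (1 - p) - \<beta> - (1 - \<beta>) * p)"
    using b by (intro mult_nonneg_nonneg) (auto simp: algebra_simps)
  also have "\<dots> = real (card ?B) * ((1 - \<beta>) * (1 - p)) - real (card ?B) * (\<beta> + (1 - \<beta>) * p)"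
    by (simp add: algebra_simps)
  also have "\<dots> \<le> real (card ?A) * ((1 - \<beta>) * (1 - p)) - real (card ?B) * (\<beta> + (1 - \<beta>) * p)"
    using card_01_le_card_10[OF S] b1 p
    by (intro diff_right_mono mult_right_mono) auto
  also have "\<dots> = (\<Sum>x\<in>unlike_pairs S. if S x then (1 - \<beta>) * (1 - p) else - \<beta> - (1 - \<beta>) * p)"
    using un(1) by (simp add: sum.If_cases Int_def algebra_simps)
  finally have pos: "0 \<le> (\<Sum>x\<in>unlike_pairs S. if S x then (1 - \<beta>) * (1 - p) else - \<beta> - (1 - \<beta>) * p)" .
  have "measure_pmf.expectation (raw_step \<beta> p S) f =
     (\<Sum>x\<in>unlike_pairs S. f S + (if S x then (1 - \<beta>) * (1 - p) else - \<beta> - (1 - \<beta>) * p))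
       / card (unlike_pairs S)"
  proof -
    have "p \<le> 1" using p by simp
    then show ?thesis
      unfolding expectation_raw_step[OF S \<beta>(1) b1 p(1) \<open>p \<le> 1\<close>]
      by (intro arg_cong2[where f = "(/)"] sum.cong refl pair_term)
  qed
  also have "\<dots> \<ge> f S"
  proof -
    have "0 < real (card (unlike_pairs S))" using un by (simp add: card_gt_0_iff)
    then show ?thesis using pos un by (simp add: sum.distrib field_simps)
  qed
  finally show ?thesis by (simp add: f_def[abs_def])
qed

section \<open>Displacement from a fixed ground state\<close>

definition misplaced :: "(int \<Rightarrow> bool) \<Rightarrow> int set" where
  "misplaced S = {x. S x \<longleftrightarrow> \<not> x < 0}"

text \<open>The distance to the interface of the ground state, counted from 1 on both sides; it takes
  equal values at \<open>x\<close> and \<open>-1 - x\<close>, the reflection that exchanges the two sides.\<close>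

definition depth :: "int \<Rightarrow> real" where
  "depth x = (if x < 0 then of_int (- x) else of_int (x + 1))"

definition displacement :: "nat \<Rightarrow> (int \<Rightarrow> bool) \<Rightarrow> real" where
  "displacement k S = (\<Sum>x\<in>misplaced S. depth x ^ k)"

text \<open>The change of the displacement when the label of \<open>x\<close> turns from 0 to 1. It increases with \<open>x\<close>,
  across the interface as well.\<close>

definition signed_depth :: "nat \<Rightarrow> int \<Rightarrow> real" where
  "signed_depth k x = (if x < 0 then - (depth x ^ k) else depth x ^ k)"

lemma depth_ge_1: "1 \<le> depth x"
  unfolding depth_def by (auto simp flip: of_int_minus of_int_add)

lemma finite_misplaced:
  assumes "S \<in> configs" shows "finite (misplaced S)"
proof -
  have "misplaced S = {x. x < 0 \<and> \<not> S x} \<union> {x. x \<ge> 0 \<and> S x}"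
    by (auto simp: misplaced_def)
  then show ?thesis using assms by (simp add: configs_def)
qed

lemma displacement_nonneg: "0 \<le> displacement k S"
  unfolding displacement_def by (intro sum_nonneg zero_le_power order_trans[OF _ depth_ge_1]) simp

lemma depth_power_le_displacement:
  assumes "S \<in> configs" "x \<in> misplaced S"
  shows "depth x ^ k \<le> displacement k S"
  unfolding displacement_def
proof (rule member_le_sum[OF assms(2) _ finite_misplaced[OF assms(1)]])
  fix y show "0 \<le> depth y ^ k" using depth_ge_1[of y] by simp
qed

lemma displacement_fun_upd:
  assumes "finite (misplaced S)"
  shows "displacement k (S(x := b)) =
    displacement k S + (of_bool b - of_bool (S x)) * signed_depth k x"
proof (cases "b = S x")
  case True
  then have "S(x := b) = S" by auto
  then show ?thesis using True by simp
next
  case False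
  show ?thesis
  proof (cases "x \<in> misplaced S")
    case True
    then have "misplaced (S(x := b)) = misplaced S - {x}"
      using False by (auto simp: misplaced_def)
    then have "displacement k (S(x := b)) = displacement k S - depth x ^ k"
      using True assms by (simp add: displacement_def sum_diff1)
    then show ?thesis using True False by (auto simp: signed_depth_def misplaced_def)
  next
    case nm: False
    then have "misplaced (S(x := b)) = insert x (misplaced S)"
      using False by (auto simp: misplaced_def)
    then have "displacement k (S(x := b)) = displacement k S + depth x ^ k"
      using nm assms by (simp add: displacement_def)
    then show ?thesis using nm False by (auto simp: signed_depth_def misplaced_def)
  qed
qed

lemma displacement_set_pair:
  assumes "S \<in> configs"
  shows "displacement k (set_pair S x a b) = displacement k S
    + (of_bool a - of_bool (S x)) * signed_depth k x
    + (of_bool b - of_bool (S (x + 1))) * signed_depth k (x + 1)"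
proof -
  have fin: "finite (misplaced S)" using assms by (rule finite_misplaced)
  then have "finite (insert x (misplaced S))" by simp
  then have fin': "finite (misplaced (S(x := a)))"
    by (rule finite_subset[rotated]) (auto simp: misplaced_def)
  show ?thesis
    unfolding set_pair_def by (simp add: displacement_fun_upd[OF fin'] displacement_fun_upd[OF fin])
qed

definition pair_depth :: "int \<Rightarrow> real" where
  "pair_depth x = min (depth x) (depth (x + 1))"

lemma pair_depth_ge_1: "1 \<le> pair_depth x"
  by (simp add: pair_depth_def depth_ge_1)

lemma power_Suc_diff_le:
  fixes w :: real assumes "1 \<le> w"
  shows "(w + 1) ^ Suc m - w ^ Suc m \<le> 2 ^ Suc m * w ^ m"
proof -
  have "(w + 1) ^ Suc m = (\<Sum>i\<le>Suc m. of_nat (Suc m choose i) * w ^ i)"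
    using binomial_ring[of w 1 "Suc m"] by simp
  also have "\<dots> = (\<Sum>i\<le>m. of_nat (Suc m choose i) * w ^ i) + w ^ Suc m" by simp
  also have "(\<Sum>i\<le>m. of_nat (Suc m choose i) * w ^ i) \<le> (\<Sum>i\<le>m. of_nat (Suc m choose i) * w ^ m)"
    using assms by (intro sum_mono mult_left_mono power_increasing) auto
  also have "\<dots> = (\<Sum>i\<le>m. of_nat (Suc m choose i)) * w ^ m" by (simp add: sum_distrib_right)
  also have "\<dots> \<le> 2 ^ Suc m * w ^ m"
  proof (rule mult_right_mono)
    have "(\<Sum>i\<le>m. real (Suc m choose i)) \<le> (\<Sum>i\<le>Suc m. real (Suc m choose i))"
      by (simp del: binomial_Suc_Suc)
    also have "\<dots> = real (\<Sum>i\<le>Suc m. Suc m choose i)" by (simp only: of_nat_sum)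
    also have "\<dots> = 2 ^ Suc m" by (simp only: choose_row_sum of_nat_power of_nat_numeral)
    finally show "(\<Sum>i\<le>m. real (Suc m choose i)) \<le> 2 ^ Suc m" .
  qed (use assms in auto)
  finally show ?thesis by simp
qed

text \<open>Moving a 1 from \<open>x\<close> to \<open>x + 1\<close>, which is what an exclusion move does, changes the displacement only
  by a derivative of the \<open>k\<close>-th power. This is also the bias between the two outcomes of a voter
  move.\<close>

lemma signed_depth_increment:
  "0 \<le> signed_depth (Suc m) (x + 1) - signed_depth (Suc m) x"
  "signed_depth (Suc m) (x + 1) - signed_depth (Suc m) x \<le> 2 ^ Suc m * pair_depth x ^ m"
proof -
  let ?d = "signed_depth (Suc m) (x + 1) - signed_depth (Suc m) x" and ?w = "pair_depth x"
  have w: "1 \<le> ?w" by (rule pair_depth_ge_1)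
  have grow: "0 \<le> (?w + 1) ^ Suc m - ?w ^ Suc m"
    using w power_mono[of ?w "?w + 1" "Suc m"] by linarith
  consider "x = -1" | "x \<ge> 0" | "x \<le> -2" by linarith
  then have "0 \<le> ?d \<and> ?d \<le> 2 ^ Suc m * ?w ^ m"
  proof cases
    case 1
    then have "?w = 1" "?d = 2" by (simp_all add: pair_depth_def depth_def signed_depth_def)
    then show ?thesis using power_increasing[of 1 "Suc m" "2::real"] by simp
  next
    case 2
    then have "?w = depth x" "depth (x + 1) = ?w + 1"
      by (simp_all add: pair_depth_def depth_def)
    with 2 have "?d = (?w + 1) ^ Suc m - ?w ^ Suc m" by (simp add: signed_depth_def)
    then show ?thesis using grow power_Suc_diff_le[OF w, of m] by simp
  next
    case 3
    then have "?w = depth (x + 1)" "depth x = ?w + 1"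
      by (simp_all add: pair_depth_def depth_def)
    with 3 have "?d = (?w + 1) ^ Suc m - ?w ^ Suc m" by (simp add: signed_depth_def)
    then show ?thesis using grow power_Suc_diff_le[OF w, of m] by simp
  qed
  then show "0 \<le> ?d" "?d \<le> 2 ^ Suc m * ?w ^ m" by auto
qed

text \<open>A voter move changes the displacement by a full \<open>k\<close>-th power: this is the noise that
  outweighs the bias of the preceding lemma.\<close>

lemma abs_signed_depth_ge:
  "pair_depth x ^ k \<le> \<bar>signed_depth k x\<bar>" "pair_depth x ^ k \<le> \<bar>signed_depth k (x + 1)\<bar>"
proof -
  have "0 \<le> depth y" for y using depth_ge_1[of y] by simp
  moreover have "0 \<le> pair_depth x" using pair_depth_ge_1[of x] by simp
  ultimately show "pair_depth x ^ k \<le> \<bar>signed_depth k x\<bar>"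
      "pair_depth x ^ k \<le> \<bar>signed_depth k (x + 1)\<bar>"
    by (auto simp: signed_depth_def pair_depth_def intro!: power_mono)
qed

text \<open>An unlike pair away from the interface contains a misplaced site, so a voter move changes the
  displacement at most by a constant factor. This keeps second-order expansions of concave
  functions of the displacement effective.\<close>

lemma abs_signed_depth_le_displacement:
  assumes S: "S \<in> configs" and x: "x \<in> unlike_pairs S" and y: "y \<in> {x, x + 1}"
  shows "\<bar>signed_depth k y\<bar> \<le> 2 ^ k * (1 + displacement k S)"
proof -
  have ab: "\<bar>signed_depth k y\<bar> = depth y ^ k"
    using depth_ge_1[of y] by (simp add: signed_depth_def)
  have ne: "S x \<noteq> S (x + 1)" using x by (simp add: unlike_pairs_def)
  have "\<exists>d\<ge>1. depth y \<le> 2 * d \<and> d ^ k \<le> 1 + displacement k S"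
  proof (cases "x = -1")
    case True
    then show ?thesis using y displacement_nonneg[of k S] by (intro exI[of _ 1]) (auto simp: depth_def)
  next
    case False
    then have "x \<in> misplaced S \<or> x + 1 \<in> misplaced S" using ne by (auto simp: misplaced_def)
    then obtain z where z: "z \<in> misplaced S" "z \<in> {x, x + 1}" by auto
    have "depth y \<le> depth z + 1" using y z(2) False by (auto simp: depth_def)
    then show ?thesis
      using depth_ge_1[of z] depth_power_le_displacement[OF S z(1), of k]
      by (intro exI[of _ "depth z"]) auto
  qed
  then obtain d where d: "d \<ge> 1" "depth y \<le> 2 * d" "d ^ k \<le> 1 + displacement k S" by auto
  have "depth y ^ k \<le> (2 * d) ^ k"
    using d depth_ge_1[of y] by (intro power_mono) auto
  also have "\<dots> = 2 ^ k * d ^ k" by (simp add: power_mult_distrib)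
  also have "\<dots> \<le> 2 ^ k * (1 + displacement k S)" using d by simp
  finally show ?thesis using ab by simp
qed

section \<open>Square roots\<close>

text \<open>With \<open>r = sqrt v\<close> and \<open>s = sqrt (v + \<delta>)\<close>, the error \<open>s - r - \<delta> / (2 r)\<close> of the tangent is exactly
  \<open>- \<delta>\<^sup>2 / (2 r (s + r)\<^sup>2)\<close>, and \<open>s + r\<close> is comparable to \<open>r\<close> when \<open>\<delta>\<close> is at most of order \<open>v\<close>.\<close>

lemma sqrt_add_le_second_order:
  fixes v \<delta> B :: real
  assumes v: "0 < v" and nn: "0 \<le> v + \<delta>" and B: "\<bar>\<delta>\<bar> \<le> B * v"
  shows "sqrt (v + \<delta>) \<le> sqrt v + \<delta> / (2 * sqrt v) - \<delta>\<^sup>2 / (4 * (2 + B) * (v * sqrt v))"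
proof -
  define r s where "r = sqrt v" and "s = sqrt (v + \<delta>)"
  have rs: "0 < r" "0 \<le> s" "r\<^sup>2 = v" "s\<^sup>2 = v + \<delta>" using v nn by (auto simp: r_def s_def)
  have \<delta>: "\<delta> = (s - r) * (s + r)" using rs by (simp add: algebra_simps power2_eq_square)
  have "s - r - \<delta> / (2 * r) = - (\<delta>\<^sup>2 / (2 * r * (s + r)\<^sup>2))"
  proof -
    have "s + r \<noteq> 0" using rs by simp
    then have "\<delta>\<^sup>2 / (2 * r * (s + r)\<^sup>2) = (s - r)\<^sup>2 / (2 * r)"
      by (simp add: \<delta> power_mult_distrib)
    moreover have "s - r - \<delta> / (2 * r) = - ((s - r)\<^sup>2 / (2 * r))"
      using rs(1) by (simp add: \<delta> field_simps power2_eq_square)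
    ultimately show ?thesis by simp
  qed
  moreover have "\<delta>\<^sup>2 / (4 * (2 + B) * (v * r)) \<le> \<delta>\<^sup>2 / (2 * r * (s + r)\<^sup>2)"
  proof (rule divide_left_mono)
    have "(s + r)\<^sup>2 \<le> 2 * (s\<^sup>2 + r\<^sup>2)"
      using sum_squares_ge_zero[of "s - r" 0] by (simp add: algebra_simps power2_eq_square)
    also have "\<dots> \<le> 2 * ((2 + B) * v)" using B by (simp add: rs algebra_simps)
    finally have "2 * r * (s + r)\<^sup>2 \<le> 2 * r * (2 * ((2 + B) * v))" using rs by (intro mult_left_mono) auto
    then show "2 * r * (s + r)\<^sup>2 \<le> 4 * (2 + B) * (v * r)" by (simp add: algebra_simps)
    have "0 < 2 * r * (s + r)\<^sup>2" using rs by simp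
    moreover from this have "0 < 4 * (2 + B) * (v * r)"
      using \<open>2 * r * (s + r)\<^sup>2 \<le> 4 * (2 + B) * (v * r)\<close> by linarith
    ultimately show "0 < 4 * (2 + B) * (v * r) * (2 * r * (s + r)\<^sup>2)"
      by (rule mult_pos_pos[rotated])
  qed simp
  ultimately show ?thesis by (simp add: r_def s_def)
qed

lemma sqrt_add_le_first_order:
  fixes v \<delta> :: real
  assumes v: "0 < v" and nn: "0 \<le> v + \<delta>"
  shows "sqrt (v + \<delta>) \<le> sqrt v + \<delta> / (2 * sqrt v)"
proof -
  have "0 \<le> \<delta>\<^sup>2 / (4 * (2 + \<bar>\<delta>\<bar> / v) * (v * sqrt v))" using v by simp
  moreover have "\<bar>\<delta>\<bar> \<le> \<bar>\<delta>\<bar> / v * v" using v by simp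
  ultimately show ?thesis using sqrt_add_le_second_order[OF v nn, of "\<bar>\<delta>\<bar> / v"] by linarith
qed

text \<open>If \<open>w ^ (4q)\<close> exceeds a constant times \<open>v\<close>, the left-hand side is negative. Otherwise
  \<open>w ^ (2q)\<close> is at most of order \<open>sqrt v\<close>, and the first term is of order \<open>w ^ (2q - 2)\<close>, which is the
  \<open>(1 - 1/q)\<close>-th power of \<open>sqrt v\<close>. The bound by \<open>T ^ (q - 1) + sqrt v / T\<close> is a form of Young's
  inequality for this power; being affine in \<open>sqrt v\<close>, it can be integrated directly, and \<open>T\<close> will
  be the time horizon.\<close>

lemma drift_noise_balance:
  fixes \<kappa> a v w :: real
  assumes \<kappa>: "0 < \<kappa>" and a: "0 \<le> a" and q: "1 \<le> q"
  shows "\<exists>C\<ge>0. \<forall>T\<ge>1. \<forall>v\<ge>1. \<forall>w\<ge>1.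
    a * w ^ (4 * q - 2) / sqrt v - \<kappa> * (w ^ (4 * q - 1))\<^sup>2 / (v * sqrt v)
      \<le> C * (T ^ (q - 1) + sqrt v / T)"
proof -
  define H where "H = a / \<kappa>"
  have H: "0 \<le> H" using assms by (simp add: H_def)
  define C where "C = a * sqrt H * (1 + sqrt H)"
  have C: "0 \<le> C" using a H by (simp add: C_def)
  have "a * w ^ (4 * q - 2) / sqrt v - \<kappa> * (w ^ (4 * q - 1))\<^sup>2 / (v * sqrt v)
      \<le> C * (T ^ (q - 1) + sqrt v / T)" if T: "1 \<le> T" and v: "1 \<le> v" and w: "1 \<le> w" for T v w :: real
  proof -
    have rhs: "0 \<le> T ^ (q - 1) + sqrt v / T" using T v by simp
    obtain j where j: "q = Suc j" using q by (cases q) auto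
    have e: "(w ^ (4 * q - 1))\<^sup>2 = w ^ (4 * q - 2) * w ^ (4 * q)"
      unfolding j power_mult[symmetric] power_add[symmetric]
      by (rule arg_cong[where f = "power w"]) simp
    have eq: "a * w ^ (4 * q - 2) / sqrt v - \<kappa> * (w ^ (4 * q - 1))\<^sup>2 / (v * sqrt v)
      = w ^ (4 * q - 2) / sqrt v * (a - \<kappa> * w ^ (4 * q) / v)"
      unfolding e using v by (simp add: field_simps)
    show ?thesis
    proof (cases "w ^ (4 * q) \<le> H * v")
      case False
      then have "a - \<kappa> * w ^ (4 * q) / v \<le> 0" using \<kappa> v by (simp add: H_def field_simps)
      then have "w ^ (4 * q - 2) / sqrt v * (a - \<kappa> * w ^ (4 * q) / v) \<le> 0"
        using w v by (intro mult_nonneg_nonpos) auto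
      also have "0 \<le> C * (T ^ (q - 1) + sqrt v / T)" using C rhs by simp
      finally show ?thesis unfolding eq .
    next
      case True
      have "(w ^ (2 * q))\<^sup>2 = w ^ (4 * q)" by (simp flip: power_mult)
      then have w2: "w ^ (2 * q) \<le> sqrt H * sqrt v"
        using True by (intro real_le_rsqrt[of "w ^ (2 * q)" "H * v", unfolded real_sqrt_mult]) simp
      have "w ^ (4 * q - 2) / sqrt v * (a - \<kappa> * w ^ (4 * q) / v) \<le> w ^ (4 * q - 2) / sqrt v * a"
        using w v \<kappa> by (intro mult_left_mono) auto
      also have "\<dots> = a * (w ^ (2 * q) * w ^ (2 * j)) / sqrt v"
        unfolding j by (simp flip: power_add)
      also have "\<dots> \<le> a * (sqrt H * sqrt v * w ^ (2 * j)) / sqrt v"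
        using w2 a w v by (intro divide_right_mono mult_left_mono mult_right_mono) auto
      also have "\<dots> = a * sqrt H * w ^ (2 * j)" using v by simp
      also have "\<dots> \<le> a * sqrt H * ((1 + sqrt H) * (T ^ j + sqrt v / T))"
      proof (intro mult_left_mono)
        have aux: "y \<le> (1 + sqrt H) * y" if "0 \<le> y" for y
          using that H by (simp add: algebra_simps)
        show "w ^ (2 * j) \<le> (1 + sqrt H) * (T ^ j + sqrt v / T)"
        proof (cases "w\<^sup>2 \<le> T")
          case True
          have "w ^ (2 * j) = (w\<^sup>2) ^ j" by (simp add: power_mult)
          also have "\<dots> \<le> T ^ j" using True by (intro power_mono) auto
          also have "\<dots> \<le> T ^ j + sqrt v / T" using T v by simp
          also have "\<dots> \<le> (1 + sqrt H) * (T ^ j + sqrt v / T)" using T v by (intro aux) simp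
          finally show ?thesis .
        next
          case False
          have "w ^ (2 * j) * T \<le> w ^ (2 * j) * w\<^sup>2" using False w by (intro mult_left_mono) auto
          also have "\<dots> = w ^ (2 * q)" unfolding j by (simp flip: power_add)
          also note w2
          finally have "w ^ (2 * j) \<le> sqrt H * (sqrt v / T)" using T by (simp add: field_simps)
          also have "\<dots> \<le> (1 + sqrt H) * (T ^ j + sqrt v / T)"
            using T v H by (intro mult_mono) auto
          finally show ?thesis .
        qed
      qed (use a H in auto)
      also have "\<dots> = C * (T ^ (q - 1) + sqrt v / T)" by (simp add: C_def j mult.assoc)
      finally show ?thesis unfolding eq .
    qed
  qed
  then show ?thesis using C by (intro exI[of _ C]) auto
qed

section \<open>Growth of the displacement\<close>

text \<open>The contribution of one unlike pair. The first-order terms are all controlled by the increment of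
  \<open>signed_depth\<close>; an exclusion move from 01 to 10 decreases the displacement. The
  second-order term is kept only for voter moves, which occur with probability \<open>\<beta>\<close>.\<close>

lemma pair_drift_bound:
  fixes S :: "int \<Rightarrow> bool" and m :: nat
  defines "F \<equiv> \<lambda>S. sqrt (1 + displacement (Suc m) S)"
  assumes S: "S \<in> configs" and x: "x \<in> unlike_pairs S"
    and \<beta>: "0 \<le> \<beta>" "\<beta> \<le> 1" and p: "0 \<le> p" "p \<le> 1"
  shows "\<beta> * ((F (set_pair S x True True) + F (set_pair S x False False)) / 2) +
        (1 - \<beta>) * (if S x then (1 - p) * F (set_pair S x False True) + p * F S
                   else p * F (set_pair S x True False) + (1 - p) * F S)
    \<le> F S + 2 ^ m * pair_depth x ^ m / sqrt (1 + displacement (Suc m) S)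
       - \<beta> / (4 * (2 + 2 ^ Suc m)) * (pair_depth x ^ Suc m)\<^sup>2 /
           ((1 + displacement (Suc m) S) * sqrt (1 + displacement (Suc m) S))"
proof -
  define v where "v = 1 + displacement (Suc m) S"
  have v: "1 \<le> v" using displacement_nonneg[of "Suc m" S] by (simp add: v_def)
  define c where "c = signed_depth (Suc m) x"
  define c' where "c' = signed_depth (Suc m) (x + 1)"
  define w where "w = pair_depth x"
  have w: "1 \<le> w" unfolding w_def by (rule pair_depth_ge_1)
  define \<kappa> :: real where "\<kappa> = 1 / (4 * (2 + 2 ^ Suc m))"
  have ne: "S (x + 1) \<longleftrightarrow> \<not> S x" using x by (auto simp: unlike_pairs_def)
  have F: "F (set_pair S x a b) =
      sqrt (v + ((of_bool a - of_bool (S x)) * c + (of_bool b - of_bool (\<not> S x)) * c'))" for a b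
    by (simp add: F_def displacement_set_pair[OF S] v_def c_def c'_def ne)
  have pos: "0 \<le> v + ((of_bool a - of_bool (S x)) * c + (of_bool b - of_bool (\<not> S x)) * c')" for a b
    using displacement_nonneg[of "Suc m" "set_pair S x a b"]
    by (simp add: displacement_set_pair[OF S] v_def c_def c'_def ne)
  have FS: "F S = sqrt v" by (simp add: F_def v_def)
  have d: "0 \<le> c' - c" "c' - c \<le> 2 ^ Suc m * w ^ m"
    using signed_depth_increment[of m x] by (simp_all add: c_def c'_def w_def)
  have cv: "\<bar>c\<bar> \<le> 2 ^ Suc m * v" "\<bar>c'\<bar> \<le> 2 ^ Suc m * v"
    using abs_signed_depth_le_displacement[OF S x, of x "Suc m"]
      abs_signed_depth_le_displacement[OF S x, of "x + 1" "Suc m"]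
    unfolding c_def c'_def v_def by auto
  have noise: "\<kappa> * (w ^ Suc m)\<^sup>2 / (v * sqrt v) \<le> \<delta>\<^sup>2 / (4 * (2 + 2 ^ Suc m) * (v * sqrt v))"
    if "w ^ Suc m \<le> \<bar>\<delta>\<bar>" for \<delta> :: real
  proof -
    have "(w ^ Suc m)\<^sup>2 \<le> \<bar>\<delta>\<bar>\<^sup>2" using that w by (intro power_mono) auto
    then have "(w ^ Suc m)\<^sup>2 / (4 * (2 + 2 ^ Suc m) * (v * sqrt v)) \<le> \<delta>\<^sup>2 / (4 * (2 + 2 ^ Suc m) * (v * sqrt v))"
      using v by (intro divide_right_mono) auto
    then show ?thesis by (simp add: \<kappa>_def)
  qed
  define e where "e = \<kappa> * (w ^ Suc m)\<^sup>2 / (v * sqrt v)"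
  define D where "D = 2 ^ m * w ^ m / sqrt v"
  have D: "(c' - c) / (2 * sqrt v) \<le> D" "0 \<le> D"
  proof -
    have "(c' - c) / (2 * sqrt v) \<le> 2 ^ Suc m * w ^ m / (2 * sqrt v)"
      using d v by (intro divide_right_mono) auto
    then show "(c' - c) / (2 * sqrt v) \<le> D" using v by (simp add: D_def)
    show "0 \<le> D" using v w by (simp add: D_def)
  qed
  have single: "sqrt (v + \<delta>) \<le> sqrt v + \<delta> / (2 * sqrt v) - e"
    if "\<bar>\<delta>\<bar> = \<bar>c\<bar> \<or> \<bar>\<delta>\<bar> = \<bar>c'\<bar>" "0 \<le> v + \<delta>" for \<delta>
  proof -
    have "\<bar>\<delta>\<bar> \<le> 2 ^ Suc m * v" using that cv by auto
    moreover have "w ^ Suc m \<le> \<bar>\<delta>\<bar>"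
      using that abs_signed_depth_ge[of x "Suc m"] unfolding c_def c'_def w_def by auto
    ultimately show ?thesis
      using sqrt_add_le_second_order[of v \<delta> "2 ^ Suc m"] noise[of \<delta>] that v unfolding e_def by linarith
  qed
  have half: "(a + b) / 2 \<le> sqrt v + D - e"
    if "a \<le> sqrt v + y - e" "b \<le> sqrt v + z - e" "y + z \<le> D" for a b y z
    using that D(2) by (simp add: field_simps)
  have voter: "(F (set_pair S x True True) + F (set_pair S x False False)) / 2 \<le> sqrt v + D - e"
  proof (cases "S x")
    case True
    show ?thesis
    proof (rule half)
      show "F (set_pair S x True True) \<le> sqrt v + c' / (2 * sqrt v) - e"
        using single[of c'] pos[of True True] True by (simp add: F)
      show "F (set_pair S x False False) \<le> sqrt v + (- c) / (2 * sqrt v) - e"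
        using single[of "- c"] pos[of False False] True by (simp add: F)
      show "c' / (2 * sqrt v) + (- c) / (2 * sqrt v) \<le> D"
        using D(1) by (simp add: diff_divide_distrib)
    qed
  next
    case False
    show ?thesis
    proof (rule half)
      show "F (set_pair S x True True) \<le> sqrt v + c / (2 * sqrt v) - e"
        using single[of c] pos[of True True] False by (simp add: F)
      show "F (set_pair S x False False) \<le> sqrt v + (- c') / (2 * sqrt v) - e"
        using single[of "- c'"] pos[of False False] False by (simp add: F)
      have "0 \<le> (c' - c) / (2 * sqrt v)" using d v by simp
      then show "c / (2 * sqrt v) + (- c') / (2 * sqrt v) \<le> D"
        using D(2) by (simp add: diff_divide_distrib)
    qed
  qed
  have excl: "(if S x then (1 - p) * F (set_pair S x False True) + p * F S
                   else p * F (set_pair S x True False) + (1 - p) * F S) \<le> sqrt v + D"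
  proof -
    have conv: "r * a + (1 - r) * b \<le> M" if "0 \<le> r" "r \<le> 1" "a \<le> M" "b \<le> M" for r a b M :: real
      using convex_bound_le[of a M b r "1 - r"] that by simp
    have "F (set_pair S x False True) \<le> sqrt v + D" if "S x"
      using sqrt_add_le_first_order[of v "c' - c"] pos[of False True] that v D by (simp add: F)
    moreover have "F (set_pair S x True False) \<le> sqrt v + D" if "\<not> S x"
    proof -
      have "F (set_pair S x True False) \<le> sqrt v" using that d by (simp add: F)
      then show ?thesis using D by linarith
    qed
    moreover have "F S \<le> sqrt v + D" using D by (simp add: FS)
    ultimately show ?thesis using p conv[of "1 - p"] conv[of p] by simp
  qed
  have "\<beta> * ((F (set_pair S x True True) + F (set_pair S x False False)) / 2) +
        (1 - \<beta>) * (if S x then (1 - p) * F (set_pair S x False True) + p * F S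
                   else p * F (set_pair S x True False) + (1 - p) * F S)
     \<le> \<beta> * (sqrt v + D - e) + (1 - \<beta>) * (sqrt v + D)"
    using voter excl \<beta> by (intro add_mono mult_left_mono) auto
  also have "\<dots> = sqrt v + D - \<beta> * e" by (simp add: algebra_simps)
  finally show ?thesis
    by (simp add: FS D_def e_def \<kappa>_def v_def w_def)
qed

text \<open>Averaging the balance of drift and noise over the unlike pairs; the constant depends on \<open>\<beta>\<close> and
  \<open>q\<close> but neither on the configuration nor on the horizon \<open>T\<close>, so the bound can be iterated.\<close>

lemma displacement_one_step:
  assumes \<beta>: "0 < \<beta>" "\<beta> \<le> 1" and p: "0 \<le> p" "p \<le> 1" and q: "1 \<le> q"
  obtains C where "0 \<le> C" "\<And>T S. 1 \<le> T \<Longrightarrow> S \<in> configs \<Longrightarrow>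
    measure_pmf.expectation (raw_step \<beta> p S) (\<lambda>S. sqrt (1 + displacement (4 * q - 1) S))
      \<le> (1 + C / T) * sqrt (1 + displacement (4 * q - 1) S) + C * T ^ (q - 1)"
proof -
  define m where "m = 4 * q - 2"
  have m: "4 * q - 1 = Suc m" using q by (simp add: m_def)
  define F where "F S = sqrt (1 + displacement (Suc m) S)" for S
  obtain C where C: "0 \<le> C" "\<And>T v w. 1 \<le> T \<Longrightarrow> 1 \<le> v \<Longrightarrow> 1 \<le> w \<Longrightarrow>
    2 ^ m * w ^ m / sqrt v - \<beta> / (4 * (2 + 2 ^ Suc m)) * (w ^ Suc m)\<^sup>2 / (v * sqrt v)
      \<le> C * (T ^ (q - 1) + sqrt v / T)"
  proof -
    have "0 < \<beta> / (4 * (2 + 2 ^ Suc m))"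
      by (intro divide_pos_pos mult_pos_pos add_pos_pos \<beta>) auto
    then show ?thesis
      using drift_noise_balance[of "\<beta> / (4 * (2 + 2 ^ Suc m))" "2 ^ m" q] q that
      unfolding m m_def[symmetric] by auto
  qed
  show ?thesis
  proof (rule that[OF C(1)])
    fix T :: real and S assume T: "1 \<le> T" and S: "S \<in> configs"
    note un = unlike_pairs_finite_nonempty[OF S]
    then have N: "0 < real (card (unlike_pairs S))" by (simp add: card_gt_0_iff)
    let ?R = "F S + C * (T ^ (q - 1) + F S / T)"
    have "measure_pmf.expectation (raw_step \<beta> p S) F \<le>
        (\<Sum>x\<in>unlike_pairs S. ?R) / card (unlike_pairs S)"
      unfolding expectation_raw_step[OF S less_imp_le[OF \<beta>(1)] \<beta>(2) p]
    proof (intro divide_right_mono sum_mono)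
      fix x assume x: "x \<in> unlike_pairs S"
      have v: "1 \<le> 1 + displacement (Suc m) S" using displacement_nonneg by simp
      show "\<beta> * ((F (set_pair S x True True) + F (set_pair S x False False)) / 2) +
        (1 - \<beta>) * (if S x then (1 - p) * F (set_pair S x False True) + p * F S
                   else p * F (set_pair S x True False) + (1 - p) * F S) \<le> ?R"
        using pair_drift_bound[OF S x less_imp_le[OF \<beta>(1)] \<beta>(2) p, of m]
          C(2)[OF T v pair_depth_ge_1[of x]]
        unfolding F_def by linarith
    qed simp
    also have "\<dots> = ?R" using N by simp
    also have "\<dots> = (1 + C / T) * F S + C * T ^ (q - 1)" by (simp add: algebra_simps)
    finally show "measure_pmf.expectation (raw_step \<beta> p S) (\<lambda>S. sqrt (1 + displacement (4 * q - 1) S))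
      \<le> (1 + C / T) * sqrt (1 + displacement (4 * q - 1) S) + C * T ^ (q - 1)"
      unfolding m F_def .
  qed
qed

section \<open>Inversions against displacement\<close>

text \<open>In every inversion at least one site is misplaced. Charge the inversion to its deeper site: a
  site of depth \<open>d\<close> then receives at most \<open>2 d\<close> inversions, as the partner lies within
  distance \<open>2 d\<close> between it and its mirror image.\<close>

lemma card_inversions_le_sum_depth:
  assumes S: "S \<in> configs"
  shows "real (card (inversions S)) \<le> 2 * (\<Sum>m\<in>misplaced S. depth m)"
proof -
  define charge :: "int \<Rightarrow> (int \<times> int) set" where
    "charge m = (if m < 0 then {m} \<times> {m<..- m - 1} else {- m..<m} \<times> {m})" for m
  have sub: "inversions S \<subseteq> (\<Union>m\<in>misplaced S. charge m)"
  proof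
    fix u assume "u \<in> inversions S"
    then obtain x y where u: "u = (x, y)" "x < y" "\<not> S x" "S y" by (auto simp: inversions_def)
    show "u \<in> (\<Union>m\<in>misplaced S. charge m)"
    proof (cases "x < 0 \<and> y + 1 \<le> - x")
      case True
      then have "x \<in> misplaced S" "u \<in> charge x" using u by (auto simp: misplaced_def charge_def)
      then show ?thesis by blast
    next
      case False
      then have "y \<in> misplaced S" "u \<in> charge y" using u by (auto simp: misplaced_def charge_def)
      then show ?thesis by blast
    qed
  qed
  have fin: "finite (charge m)" for m by (simp add: charge_def)
  have "card (inversions S) \<le> card (\<Union>m\<in>misplaced S. charge m)"
    using sub finite_misplaced[OF S] fin by (intro card_mono) auto
  also have "\<dots> \<le> (\<Sum>m\<in>misplaced S. card (charge m))"
    by (rule card_UN_le[OF finite_misplaced[OF S]])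
  finally have "real (card (inversions S)) \<le> (\<Sum>m\<in>misplaced S. real (card (charge m)))"
    by (simp flip: of_nat_sum)
  also have "\<dots> \<le> (\<Sum>m\<in>misplaced S. 2 * depth m)"
    by (intro sum_mono) (auto simp: charge_def depth_def card_cartesian_product)
  finally show ?thesis by (simp add: sum_distrib_left)
qed

lemma sum_depth_shallow_le:
  assumes "finite A" "0 \<le> \<rho>"
  shows "(\<Sum>m\<in>{m \<in> A. depth m \<le> \<rho>}. depth m) \<le> 2 * \<rho>\<^sup>2"
proof -
  let ?B = "{- \<lfloor>\<rho>\<rfloor>..<\<lfloor>\<rho>\<rfloor>}"
  have sub: "{m \<in> A. depth m \<le> \<rho>} \<subseteq> ?B"
  proof
    fix m assume "m \<in> {m \<in> A. depth m \<le> \<rho>}"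
    then have "depth m \<le> \<rho>" by simp
    then have "(if m < 0 then - m else m + 1) \<le> \<lfloor>\<rho>\<rfloor>"
      by (simp add: le_floor_iff depth_def split: if_splits)
    then show "m \<in> ?B" by (auto split: if_splits)
  qed
  have "(\<Sum>m\<in>{m \<in> A. depth m \<le> \<rho>}. depth m) \<le> real (card {m \<in> A. depth m \<le> \<rho>}) * \<rho>"
    by (rule sum_bounded_above) simp
  also have "\<dots> \<le> real (card ?B) * \<rho>"
    using card_mono[OF finite_atLeastLessThan_int sub] assms(2)
    by (intro mult_right_mono of_nat_mono)
  also have "\<dots> \<le> (2 * \<rho>) * \<rho>"
  proof (rule mult_right_mono)
    have "0 \<le> \<lfloor>\<rho>\<rfloor>" using assms by simp
    then show "real (card ?B) \<le> 2 * \<rho>" by simp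
  qed fact
  finally show ?thesis by (simp add: power2_eq_square)
qed

text \<open>Split the misplaced sites at depth \<open>\<rho>\<close>, where \<open>\<rho> ^ (4q)\<close> is the displacement. There are at most
  \<open>2 \<rho>\<close> sites of depth up to \<open>\<rho>\<close>, so these contribute at most \<open>2 \<rho>\<^sup>2\<close> to the sum of the depths; for
  a deeper site \<open>d \<le> d ^ (4q - 1) / \<rho> ^ (4q - 2)\<close>, and these contribute at most \<open>\<rho>\<^sup>2\<close>.\<close>

lemma card_inversions_power_le:
  assumes S: "S \<in> configs" and q: "1 \<le> q"
  shows "real (card (inversions S)) ^ q \<le> 6 ^ q * sqrt (1 + displacement (4 * q - 1) S)"
proof (cases "misplaced S = {}")
  case True
  then have "real (card (inversions S)) = 0" using card_inversions_le_sum_depth[OF S] by simp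
  then show ?thesis using q displacement_nonneg[of "4 * q - 1" S] by (simp add: power_0_left)
next
  case False
  define U where "U = displacement (4 * q - 1) S"
  define \<rho> where "\<rho> = root (4 * q) U"
  note fin = finite_misplaced[OF S]
  from False obtain x where "x \<in> misplaced S" by blast
  then have "1 \<le> U"
    using depth_power_le_displacement[OF S, of x "4 * q - 1"] one_le_power[OF depth_ge_1[of x], of "4 * q - 1"]
    unfolding U_def by linarith
  then have \<rho>: "1 \<le> \<rho>" "\<rho> ^ (4 * q) = U" using q by (simp_all add: \<rho>_def)
  have deep: "(\<Sum>m\<in>{m \<in> misplaced S. \<not> depth m \<le> \<rho>}. depth m) \<le> \<rho>\<^sup>2"
  proof -
    have "(\<Sum>m\<in>{m \<in> misplaced S. \<not> depth m \<le> \<rho>}. depth m) * \<rho> ^ (4 * q - 2)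
        = (\<Sum>m\<in>{m \<in> misplaced S. \<not> depth m \<le> \<rho>}. depth m * \<rho> ^ (4 * q - 2))"
      by (rule sum_distrib_right)
    also have "\<dots> \<le> (\<Sum>m\<in>{m \<in> misplaced S. \<not> depth m \<le> \<rho>}. depth m ^ (4 * q - 1))"
    proof (rule sum_mono)
      fix m assume "m \<in> {m \<in> misplaced S. \<not> depth m \<le> \<rho>}"
      then have "depth m * \<rho> ^ (4 * q - 2) \<le> depth m * depth m ^ (4 * q - 2)"
        using \<rho> by (intro mult_left_mono power_mono) auto
      also have "\<dots> = depth m ^ (4 * q - 1)"
        using q unfolding power_Suc[symmetric] by (intro arg_cong[where f = "power (depth m)"]) simp
      finally show "depth m * \<rho> ^ (4 * q - 2) \<le> depth m ^ (4 * q - 1)" .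
    qed
    also have "\<dots> \<le> U"
      unfolding U_def displacement_def
    proof (rule sum_mono2[OF fin])
      fix b show "0 \<le> depth b ^ (4 * q - 1)" using depth_ge_1[of b] by simp
    qed auto
    also have "U = \<rho>\<^sup>2 * \<rho> ^ (4 * q - 2)"
      using q unfolding \<rho>(2)[symmetric] power_add[symmetric] by (intro arg_cong[where f = "power \<rho>"]) simp
    finally show ?thesis using \<rho>(1) by simp
  qed
  have "(\<Sum>m\<in>misplaced S. depth m) =
      (\<Sum>m\<in>{m \<in> misplaced S. depth m \<le> \<rho>}. depth m) + (\<Sum>m\<in>{m \<in> misplaced S. \<not> depth m \<le> \<rho>}. depth m)"
    using fin by (subst sum.union_disjoint[symmetric]) (auto intro!: sum.cong)
  then have "real (card (inversions S)) \<le> 6 * \<rho>\<^sup>2"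
    using card_inversions_le_sum_depth[OF S] sum_depth_shallow_le[OF fin, of \<rho>] deep \<rho>(1) by linarith
  then have "real (card (inversions S)) ^ q \<le> (6 * \<rho>\<^sup>2) ^ q" by (intro power_mono) auto
  also have "\<dots> = 6 ^ q * \<rho> ^ (2 * q)" by (simp add: power_mult_distrib power_mult)
  also have "\<rho> ^ (2 * q) = sqrt U"
  proof -
    have "(\<rho> ^ (2 * q))\<^sup>2 = U" using \<rho>(2) by (simp add: power_mult[symmetric])
    then show ?thesis using \<rho>(1) by (intro real_sqrt_unique[symmetric]) auto
  qed
  also have "6 ^ q * sqrt U \<le> 6 ^ q * sqrt (1 + U)" by simp
  finally show ?thesis by (simp add: U_def)
qed

section \<open>Moments of the number of inversions\<close>

primrec iterate_kernel :: "('s \<Rightarrow> 's pmf) \<Rightarrow> 's \<Rightarrow> nat \<Rightarrow> 's pmf" where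
  "iterate_kernel K s 0 = return_pmf s"
| "iterate_kernel K s (Suc t) = iterate_kernel K s t \<bind> K"

lemma iterate_raw_step_configs:
  assumes "S \<in> configs" "T \<in> set_pmf (iterate_kernel (raw_step \<beta> p) S t)"
  shows "T \<in> configs"
  using assms(2)
proof (induction t arbitrary: T)
  case 0
  then show ?case using assms(1) by simp
next
  case (Suc t)
  then obtain R where "R \<in> set_pmf (iterate_kernel (raw_step \<beta> p) S t)" "T \<in> set_pmf (raw_step \<beta> p R)"
    by auto
  then show ?case using Suc.IH raw_step_in_configs by blast
qed

lemma finite_iterate_raw_step:
  assumes "S \<in> configs" shows "finite (set_pmf (iterate_kernel (raw_step \<beta> p) S t))"
proof (induction t)
  case (Suc t)
  then show ?case
    using finite_set_pmf_raw_step iterate_raw_step_configs[OF assms] by auto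
qed simp

lemma expectation_bind_finite:
  fixes h :: "'b \<Rightarrow> real"
  assumes "finite (set_pmf M)" "\<And>x. x \<in> set_pmf M \<Longrightarrow> finite (set_pmf (N x))"
  shows "measure_pmf.expectation (M \<bind> N) h = measure_pmf.expectation M (\<lambda>x. measure_pmf.expectation (N x) h)"
  using assms by (simp add: pmf_expectation_bind[of "set_pmf M"] integral_measure_pmf[of "set_pmf M"])

lemma expectation_mono_finite:
  fixes g h :: "'b \<Rightarrow> real"
  assumes "finite (set_pmf M)" "\<And>x. x \<in> set_pmf M \<Longrightarrow> g x \<le> h x"
  shows "measure_pmf.expectation M g \<le> measure_pmf.expectation M h"
  using assms by (intro integral_mono_AE integrable_measure_pmf_finite) (auto simp: AE_measure_pmf_iff)

lemma affine_recursion_bound: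
  fixes u :: "nat \<Rightarrow> real"
  assumes "\<And>s. u (Suc s) \<le> a * u s + b" "1 \<le> a" "0 \<le> b" "0 \<le> u 0"
  shows "u s \<le> a ^ s * (u 0 + real s * b)"
proof (induction s)
  case (Suc s)
  have "u (Suc s) \<le> a * (a ^ s * (u 0 + real s * b)) + b"
    using assms(1)[of s] mult_left_mono[OF Suc, of a] assms(2) by linarith
  moreover have "b \<le> a ^ Suc s * b"
    using mult_right_mono[OF one_le_power[OF assms(2), of "Suc s"] assms(3)] by simp
  moreover have "a ^ Suc s * (u 0 + real (Suc s) * b) = a * (a ^ s * (u 0 + real s * b)) + a ^ Suc s * b"
    by (simp add: algebra_simps)
  ultimately show ?case by linarith
qed simp

text \<open>Up to time \<open>t\<close> the one-step bound is used with \<open>T = t\<close>: the factors \<open>1 + C / t\<close> multiply to at most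
  \<open>exp C\<close>, and the additive terms \<open>C t ^ (q - 1)\<close> add up to \<open>C t ^ q\<close>.\<close>

lemma inversions_moment_with_voter:
  assumes S: "S \<in> configs" and \<beta>: "0 < \<beta>" "\<beta> \<le> 1" and p: "0 \<le> p" "p \<le> 1" and q: "1 \<le> q"
  shows "\<exists>C. \<forall>t\<ge>1. measure_pmf.expectation (iterate_kernel (raw_step \<beta> p) S t)
    (\<lambda>S. real (card (inversions S)) ^ q) \<le> C * real t ^ q"
proof -
  define F where "F S = sqrt (1 + displacement (4 * q - 1) S)" for S
  define u where "u s = measure_pmf.expectation (iterate_kernel (raw_step \<beta> p) S s) F" for s
  obtain C where C: "0 \<le> C" and step: "\<And>T S. 1 \<le> T \<Longrightarrow> S \<in> configs \<Longrightarrow>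
      measure_pmf.expectation (raw_step \<beta> p S) F \<le> (1 + C / T) * F S + C * T ^ (q - 1)"
    using displacement_one_step[OF \<beta> p q] unfolding F_def by metis
  have F0: "0 \<le> F S" for S using displacement_nonneg by (simp add: F_def)
  have bound: "measure_pmf.expectation (iterate_kernel (raw_step \<beta> p) S t)
    (\<lambda>S. real (card (inversions S)) ^ q) \<le> (6 ^ q * exp C * (F S + C)) * real t ^ q" if t: "1 \<le> t" for t
  proof -
    let ?T = "real t"
    have T: "1 \<le> ?T" using t by simp
    have rec: "u (Suc s) \<le> (1 + C / ?T) * u s + C * ?T ^ (q - 1)" for s
    proof -
      have "u (Suc s) = measure_pmf.expectation (iterate_kernel (raw_step \<beta> p) S s)
          (\<lambda>S. measure_pmf.expectation (raw_step \<beta> p S) F)"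
        unfolding u_def iterate_kernel.simps
        using finite_iterate_raw_step[OF S] finite_set_pmf_raw_step iterate_raw_step_configs[OF S]
        by (intro expectation_bind_finite) auto
      also have "\<dots> \<le> measure_pmf.expectation (iterate_kernel (raw_step \<beta> p) S s)
          (\<lambda>S. (1 + C / ?T) * F S + C * ?T ^ (q - 1))"
        using finite_iterate_raw_step[OF S] iterate_raw_step_configs[OF S] step[OF T]
        by (intro expectation_mono_finite) auto
      also have "\<dots> = (1 + C / ?T) * u s + C * ?T ^ (q - 1)"
        using finite_iterate_raw_step[OF S]
        by (simp add: u_def integrable_measure_pmf_finite)
      finally show ?thesis .
    qed
    have "u t \<le> (1 + C / ?T) ^ t * (u 0 + ?T * (C * ?T ^ (q - 1)))"
      using C T F0 by (intro affine_recursion_bound rec) (auto simp: u_def)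
    also have "\<dots> = (1 + C / ?T) ^ t * (F S + C * ?T ^ q)"
      using q by (cases q) (simp_all add: u_def algebra_simps)
    also have "\<dots> \<le> exp C * (F S * ?T ^ q + C * ?T ^ q)"
    proof (intro mult_mono add_right_mono)
      show "(1 + C / ?T) ^ t \<le> exp C"
        using exp_ge_one_plus_x_over_n_power_n[of t C] C t by simp
      show "F S \<le> F S * ?T ^ q" using F0[of S] one_le_power[OF T, of q] mult_left_mono[of 1 "?T ^ q" "F S"] by simp
    qed (use C F0 in auto)
    finally have ut: "u t \<le> exp C * (F S + C) * ?T ^ q" by (simp add: algebra_simps)
    have "measure_pmf.expectation (iterate_kernel (raw_step \<beta> p) S t)
        (\<lambda>S. real (card (inversions S)) ^ q)
      \<le> measure_pmf.expectation (iterate_kernel (raw_step \<beta> p) S t) (\<lambda>S. 6 ^ q * F S)"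
      using finite_iterate_raw_step[OF S] iterate_raw_step_configs[OF S] card_inversions_power_le[OF _ q]
      unfolding F_def by (intro expectation_mono_finite) auto
    also have "\<dots> = 6 ^ q * u t" by (simp add: u_def)
    also have "\<dots> \<le> 6 ^ q * (exp C * (F S + C) * ?T ^ q)" using ut by simp
    finally show ?thesis by (simp add: algebra_simps)
  qed
  then show ?thesis by blast
qed

text \<open>Exclusion moves alone create at most one inversion per step. This case is separate because the
  constants of the previous lemma blow up as \<open>\<beta>\<close> tends to 0.\<close>

lemma inversions_moment_without_voter:
  assumes S: "S \<in> configs"
  shows "\<exists>C. \<forall>t\<ge>1. measure_pmf.expectation (iterate_kernel (raw_step 0 p) S t)
    (\<lambda>S. real (card (inversions S)) ^ q) \<le> C * real t ^ q"
proof -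
  let ?f = "\<lambda>S. card (inversions S)"
  have one: "?f T \<le> ?f S + 1" if conf: "S \<in> configs" and reach: "T \<in> set_pmf (raw_step 0 p S)" for S T
  proof -
    have "set_pmf (bernoulli_pmf 0) = {False}" by (auto simp: set_pmf_eq split: if_splits)
    with reach unlike_pairs_finite_nonempty[OF conf] obtain x
      where x: "x \<in> unlike_pairs S" and "T \<in> set_pmf (exclusion_move p S x)"
      by (auto simp: raw_step_def)
    then have T: "T = S \<or> T = set_pair S x (\<not> S x) (S x)"
      by (auto simp: exclusion_move_def split: if_splits)
    obtain r zl ro :: nat where *: "\<And>a b. ?f (set_pair S x a b) =
       r + (of_bool (\<not> a) + of_bool (\<not> b)) * ro + (of_bool a + of_bool b) * zl + of_bool (\<not> a \<and> b)"
      using card_inversions_set_pair[OF conf] by metis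
    have "?f S = ?f (set_pair S x (S x) (S (x + 1)))" by (simp only: set_pair_same)
    then show ?thesis using x T by (cases "S x") (auto simp: * unlike_pairs_def)
  qed
  have lin: "?f T \<le> ?f S + t" if "T \<in> set_pmf (iterate_kernel (raw_step 0 p) S t)" for T t
    using that
  proof (induction t arbitrary: T)
    case (Suc t)
    then obtain R where R: "R \<in> set_pmf (iterate_kernel (raw_step 0 p) S t)" "T \<in> set_pmf (raw_step 0 p R)"
      by auto
    then show ?case using Suc.IH[OF R(1)] one[OF iterate_raw_step_configs[OF S R(1)] R(2)] by simp
  qed simp
  have "measure_pmf.expectation (iterate_kernel (raw_step 0 p) S t) (\<lambda>S. real (?f S) ^ q)
      \<le> (real (?f S) + 1) ^ q * real t ^ q" if t: "1 \<le> t" for t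
  proof -
    have "measure_pmf.expectation (iterate_kernel (raw_step 0 p) S t) (\<lambda>S. real (?f S) ^ q)
      \<le> measure_pmf.expectation (iterate_kernel (raw_step 0 p) S t) (\<lambda>_. ((real (?f S) + 1) * real t) ^ q)"
    proof (intro expectation_mono_finite finite_iterate_raw_step[OF S] power_mono)
      fix T assume "T \<in> set_pmf (iterate_kernel (raw_step 0 p) S t)"
      then have "real (?f T) \<le> real (?f S) * 1 + real t" using lin by fastforce
      also have "\<dots> \<le> real (?f S) * real t + real t" using t by (intro add_right_mono mult_left_mono) auto
      finally show "real (?f T) \<le> (real (?f S) + 1) * real t" by (simp add: algebra_simps)
    qed simp
    then show ?thesis by (simp add: power_mult_distrib)
  qed
  then show ?thesis by blast
qed

section \<open>Inversions modulo translation\<close>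

lemma translates_refl_iff: "translates S S \<longleftrightarrow> S \<in> configs"
  by (auto simp: translates_def intro!: exI[of _ 0])

lemma config_obtain_rep:
  obtains S where "S \<in> configs" "c = abs_config S"
proof (rule that[of "rep_config c"])
  show "rep_config c \<in> configs"
    using Quotient3_rep_reflp[OF Quotient3_config, of c] by (simp add: translates_refl_iff)
  show "c = abs_config (rep_config c)"
    using Quotient3_abs_rep[OF Quotient3_config, of c] by simp
qed

lift_definition inversion_number :: "config \<Rightarrow> nat" is "\<lambda>S. card (inversions S)"
proof -
  fix S T assume "translates S T"
  then obtain k where k: "\<And>x. T x = S (x + k)" by (auto simp: translates_def)
  have "bij_betw (\<lambda>(x, y). (x + k, y + k)) (inversions T) (inversions S)"
    by (rule bij_betw_byWitness[where f' = "\<lambda>(x, y). (x - k, y - k)"])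
      (auto simp: inversions_def k)
  then show "card (inversions S) = card (inversions T)"
    by (simp add: bij_betw_same_card)
qed

lemma inversion_number_abs: "S \<in> configs \<Longrightarrow> inversion_number (abs_config S) = card (inversions S)"
  by (simp add: inversion_number.abs_eq translates_refl_iff)

lemma step_abs: "S \<in> configs \<Longrightarrow> step \<beta> p (abs_config S) = map_pmf abs_config (raw_step \<beta> p S)"
  by (simp add: step.abs_eq translates_refl_iff)

lemma inversion_number_ground_state: "inversion_number ground_state = 0"
proof -
  have "inversions (\<lambda>x. x < 0) = {}" by (auto simp: inversions_def)
  then show ?thesis by transfer simp
qed

text \<open>Without inversions every 1 lies to the left of every 0, so the configuration is the Heaviside
  configuration translated to its leftmost 0.\<close>

lemma inversion_number_pos:
  assumes "c \<noteq> ground_state" shows "1 \<le> inversion_number c"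
proof (rule ccontr)
  assume z: "\<not> 1 \<le> inversion_number c"
  obtain S where S: "S \<in> configs" "c = abs_config S" by (rule config_obtain_rep)
  have inv: "inversions S = {}"
    using z S finite_inversions[OF S(1)] by (simp add: inversion_number_abs not_le)
  from configs_obtain_bounds[OF S(1)] obtain n
    where n: "n > 0" "\<And>x. x < -n \<Longrightarrow> S x" "\<And>x. x \<ge> n \<Longrightarrow> \<not> S x" by metis
  \<comment> \<open>the part of the zeros that contains the leftmost one, made finite\<close>
  define Z where "Z = {x \<in> {-n..n}. \<not> S x}"
  have "finite Z" unfolding Z_def by (rule finite_subset[of _ "{-n..n}"]) auto
  have "n \<in> Z" using n by (auto simp: Z_def)
  with \<open>finite Z\<close> have k: "Min Z \<in> Z" "\<And>x. x \<in> Z \<Longrightarrow> Min Z \<le> x" using Min_in by auto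
  have "S x \<longleftrightarrow> x < Min Z" for x
  proof
    assume "S x"
    have "\<not> (Min Z < x)"
    proof
      assume "Min Z < x"
      then have "(Min Z, x) \<in> inversions S" using k(1) \<open>S x\<close> by (auto simp: inversions_def Z_def)
      then show False using inv by simp
    qed
    moreover have "x \<noteq> Min Z" using k(1) \<open>S x\<close> by (auto simp: Z_def)
    ultimately show "x < Min Z" by linarith
  next
    assume x: "x < Min Z"
    show "S x"
    proof (rule ccontr)
      assume "\<not> S x"
      moreover have "x \<le> n" using x k(2)[OF \<open>n \<in> Z\<close>] by simp
      moreover have "- n \<le> x" using n(2)[of x] \<open>\<not> S x\<close> by linarith
      ultimately have "x \<in> Z" by (simp add: Z_def)
      then show False using k(2)[of x] x by simp
    qed
  qed
  then have "\<forall>x. S x = (x + - Min Z < 0)" by auto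
  then have "translates (\<lambda>x. x < 0) S"
    unfolding translates_def using S(1) heaviside_in_configs by blast
  then have "abs_config (\<lambda>x. x < 0) = abs_config S"
    by (rule Quotient3_rel_abs[OF Quotient3_config])
  then have "c = ground_state" unfolding ground_state_def S(2) by (rule sym)
  then show False using assms by contradiction
qed

lemma finite_set_pmf_step: "finite (set_pmf (step \<beta> p c))"
  by (rule config_obtain_rep[of c]) (simp add: step_abs finite_set_pmf_raw_step)

lemma inversion_number_submartingale:
  assumes "0 \<le> p" "p < 1 / 2" "0 \<le> \<beta>" "\<beta> \<le> (1 - 2 * p) / (2 - 2 * p)"
  shows "inversion_number c \<le> measure_pmf.expectation (step \<beta> p c) (\<lambda>c. real (inversion_number c))"
proof -
  obtain S where S: "S \<in> configs" "c = abs_config S" by (rule config_obtain_rep)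
  have "measure_pmf.expectation (step \<beta> p c) (\<lambda>c. real (inversion_number c))
      = measure_pmf.expectation (raw_step \<beta> p S) (\<lambda>S. real (inversion_number (abs_config S)))"
    unfolding S(2) step_abs[OF S(1)] by simp
  also have "\<dots> = measure_pmf.expectation (raw_step \<beta> p S) (\<lambda>S. real (card (inversions S)))"
    using raw_step_in_configs[OF S(1)]
    by (intro integral_cong_AE) (auto simp: AE_measure_pmf_iff inversion_number_abs)
  finally show ?thesis
    using inversions_submartingale[OF S(1) assms] by (simp add: S inversion_number_abs)
qed

lemma iterate_step_abs:
  assumes "S \<in> configs"
  shows "iterate_kernel (step \<beta> p) (abs_config S) t
    = map_pmf abs_config (iterate_kernel (raw_step \<beta> p) S t)"
proof (induction t)
  case (Suc t)
  have "iterate_kernel (step \<beta> p) (abs_config S) (Suc t) =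
      iterate_kernel (raw_step \<beta> p) S t \<bind> (\<lambda>S. step \<beta> p (abs_config S))"
    by (simp add: Suc bind_map_pmf)
  also have "\<dots> = iterate_kernel (raw_step \<beta> p) S t \<bind> (\<lambda>S. map_pmf abs_config (raw_step \<beta> p S))"
    by (intro bind_pmf_cong refl step_abs iterate_raw_step_configs[OF assms])
  finally show ?case by (simp add: map_bind_pmf)
qed simp

lemma inversion_number_moment:
  assumes \<beta>: "0 \<le> \<beta>" "\<beta> \<le> 1" and p: "0 \<le> p" "p \<le> 1" and q: "1 \<le> q"
  shows "\<exists>C. \<forall>t\<ge>1. measure_pmf.expectation (iterate_kernel (step \<beta> p) c t)
    (\<lambda>c. real (inversion_number c) ^ q) \<le> C * real t ^ q"
proof -
  obtain S where S: "S \<in> configs" "c = abs_config S" by (rule config_obtain_rep)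
  have "measure_pmf.expectation (iterate_kernel (step \<beta> p) c t) (\<lambda>c. real (inversion_number c) ^ q)
      = measure_pmf.expectation (iterate_kernel (raw_step \<beta> p) S t) (\<lambda>S. real (card (inversions S)) ^ q)" for t
    unfolding S(2) iterate_step_abs[OF S(1)] integral_map_pmf
    using iterate_raw_step_configs[OF S(1)]
    by (intro integral_cong_AE) (auto simp: AE_measure_pmf_iff inversion_number_abs)
  then show ?thesis
    using inversions_moment_without_voter[OF S(1), of p q]
      inversions_moment_with_voter[OF S(1) _ \<beta>(2) p q] \<beta>(1)
    by (cases "\<beta> = 0") auto
qed

text \<open>The misplaced sites form a finite set and determine the configuration. Countability makes all
  sets of finite histories measurable.\<close>

instance config :: countable
proof
  define enc :: "(int \<Rightarrow> bool) \<Rightarrow> int set \<times> int set" where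
    "enc S = ({x. x < 0 \<and> \<not> S x}, {x. x \<ge> 0 \<and> S x})" for S
  have "inj_on enc configs"
  proof (rule inj_onI)
    fix S T assume "enc S = enc T"
    then have "x \<in> fst (enc S) \<longleftrightarrow> x \<in> fst (enc T)" "x \<in> snd (enc S) \<longleftrightarrow> x \<in> snd (enc T)" for x
      by simp_all
    then have "S x = T x" for x
      unfolding enc_def fst_conv snd_conv mem_Collect_eq by (meson not_less)
    then show "S = T" by auto
  qed
  moreover have "enc ` configs \<subseteq> {A. finite A} \<times> {A. finite A}"
    by (auto simp: enc_def configs_def)
  moreover have "countable ({A :: int set. finite A} \<times> {A :: int set. finite A})"
    by (intro countable_SIGMA countable_Collect_finite)
  ultimately have "countable configs"
    using countable_subset countable_image_inj_on by blast
  moreover have "(UNIV :: config set) = abs_config ` configs"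
    using config_obtain_rep by (metis (no_types, lifting) UNIV_eq_I imageI)
  ultimately have "countable (UNIV :: config set)" by (metis countable_image)
  then show "\<exists>to_nat :: config \<Rightarrow> nat. inj to_nat" by (auto simp: countable_def)
qed

section \<open>Histories of a Markov chain\<close>

text \<open>Histories are recorded with the latest state first, so that the head is the current state.\<close>

primrec history :: "('s \<Rightarrow> 's pmf) \<Rightarrow> 's \<Rightarrow> nat \<Rightarrow> 's list pmf" where
  "history K s 0 = return_pmf [s]"
| "history K s (Suc t) = history K s t \<bind> (\<lambda>xs. map_pmf (\<lambda>y. y # xs) (K (hd xs)))"

primrec observed :: "(nat \<Rightarrow> 'w \<Rightarrow> 's) \<Rightarrow> nat \<Rightarrow> 'w \<Rightarrow> 's list" where
  "observed \<xi> 0 \<omega> = [\<xi> 0 \<omega>]"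
| "observed \<xi> (Suc t) \<omega> = \<xi> (Suc t) \<omega> # observed \<xi> t \<omega>"

lemma map_hd_history: "map_pmf hd (history K s t) = iterate_kernel K s t"
proof (induction t)
  case (Suc t)
  have "map_pmf hd (history K s (Suc t)) = history K s t \<bind> (\<lambda>xs. K (hd xs))"
    by (simp add: map_bind_pmf pmf.map_comp o_def)
  also have "\<dots> = map_pmf hd (history K s t) \<bind> K" by (simp add: bind_map_pmf)
  finally show ?case by (simp add: Suc)
qed simp

lemma finite_set_pmf_history:
  assumes "\<And>x. finite (set_pmf (K x))" shows "finite (set_pmf (history K s t))"
  by (induction t) (simp_all add: assms)

lemma pmf_history_Suc:
  "pmf (history K s (Suc t)) (y # ys) = pmf (history K s t) ys * pmf (K (hd ys)) y"
proof -
  have "pmf (map_pmf (\<lambda>y. y # xs) (K (hd xs))) (y # ys) = indicator {ys} xs * pmf (K (hd ys)) y" for xs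
  proof (cases "xs = ys")
    case True
    then show ?thesis using pmf_map_inj'[of "\<lambda>y. y # ys" "K (hd ys)" y] by (simp add: inj_def)
  next
    case False
    then show ?thesis by (auto intro!: pmf_map_outside)
  qed
  then show ?thesis by (simp add: pmf_bind measure_pmf_single)
qed

lemma observed_eq_iff: "observed \<xi> t \<omega> = observed \<xi> t \<omega>' \<longleftrightarrow> (\<forall>i\<le>t. \<xi> i \<omega> = \<xi> i \<omega>')"
  by (induction t) (auto simp: le_Suc_eq)

lemma hd_observed: "hd (observed \<xi> t \<omega>) = \<xi> t \<omega>"
  by (cases t) auto

lemma set_observed: "set (observed \<xi> t \<omega>) = (\<lambda>i. \<xi> i \<omega>) ` {..t}"
  by (induction t) (auto simp: atMost_Suc)

lemma measurable_observed:
  fixes \<xi> :: "nat \<Rightarrow> 'w \<Rightarrow> 's :: countable"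
  assumes "\<And>t. \<xi> t \<in> measurable M (count_space UNIV)"
  shows "observed \<xi> t \<in> measurable M (count_space UNIV)"
proof (induction t)
  case 0
  show ?case using assms[of 0] unfolding observed.simps[abs_def] by measurable
next
  case (Suc t)
  note [measurable] = Suc assms
  show ?case by (simp cong: measurable_cong)
qed

text \<open>The defining property of a Markov chain speaks about conditional probabilities given histories of
  positive probability; a history that cannot be observed contributes 0 on both sides.\<close>

lemma prob_observed:
  fixes \<xi> :: "nat \<Rightarrow> 'w \<Rightarrow> 's :: countable"
  assumes mc: "markov_chain K M \<xi>"
  shows "\<P>(\<omega> in M. \<xi> 0 \<omega> = s \<and> observed \<xi> t \<omega> = xs) = \<P>(\<omega> in M. \<xi> 0 \<omega> = s) * pmf (history K s t) xs"
proof (induction t arbitrary: xs)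
  case 0
  show ?case
  proof (cases "xs = [s]")
    case True
    then have "{\<omega> \<in> space M. \<xi> 0 \<omega> = s \<and> observed \<xi> 0 \<omega> = xs} = {\<omega> \<in> space M. \<xi> 0 \<omega> = s}" by auto
    then show ?thesis using True by simp
  next
    case False
    then have "{\<omega> \<in> space M. \<xi> 0 \<omega> = s \<and> observed \<xi> 0 \<omega> = xs} = {}" by auto
    then have "\<P>(\<omega> in M. \<xi> 0 \<omega> = s \<and> observed \<xi> 0 \<omega> = xs) = 0" by (simp only: measure_empty)
    moreover have "pmf (history K s 0) xs = 0" using False by simp
    ultimately show ?thesis by simp
  qed
next
  case (Suc t)
  interpret prob_space M using mc by (simp add: markov_chain_def)
  have meas: "\<xi> t \<in> measurable M (count_space UNIV)" for t using mc by (simp add: markov_chain_def)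
  note [measurable] = meas measurable_observed[OF meas]
  show ?case
  proof (cases xs)
    case Nil
    have "[] \<notin> set_pmf (history K s (Suc t))" by auto
    then show ?thesis using Nil by (simp add: set_pmf_iff del: history.simps)
  next
    case (Cons y ys)
    let ?A = "{\<omega> \<in> space M. \<xi> 0 \<omega> = s \<and> observed \<xi> t \<omega> = ys}"
    let ?B = "{\<omega> \<in> space M. \<xi> (Suc t) \<omega> = y \<and> \<xi> 0 \<omega> = s \<and> observed \<xi> t \<omega> = ys}"
    have "prob ?B = prob ?A * pmf (K (hd ys)) y"
    proof (cases "prob ?A = 0")
      case True
      have "prob ?B \<le> prob ?A" by (intro finite_measure_mono) auto
      then show ?thesis using True measure_nonneg[of M ?B] by simp
    next
      case False
      then have pos: "prob ?A > 0" using measure_nonneg[of M ?A] by linarith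
      have "?A \<noteq> {}" using False by (metis measure_empty)
      then obtain \<omega>' where \<omega>': "\<xi> 0 \<omega>' = s" "observed \<xi> t \<omega>' = ys" by auto
      have ev: "\<xi> 0 \<omega> = s \<and> observed \<xi> t \<omega> = ys \<longleftrightarrow> (\<forall>i\<le>t. \<xi> i \<omega> = \<xi> i \<omega>')" for \<omega>
        using \<omega>' observed_eq_iff[of \<xi> t \<omega> \<omega>'] by auto
      have "\<P>(\<omega> in M. \<xi> (Suc t) \<omega> = y \<bar> \<forall>i\<le>t. \<xi> i \<omega> = \<xi> i \<omega>') = pmf (K (\<xi> t \<omega>')) y"
        using mc pos unfolding ev markov_chain_def by simp
      then show ?thesis
        using pos hd_observed[of \<xi> t \<omega>'] \<omega>' unfolding ev cond_prob_def by (simp add: field_simps)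
    qed
    moreover have "{\<omega> \<in> space M. \<xi> 0 \<omega> = s \<and> observed \<xi> (Suc t) \<omega> = xs} = ?B"
      using Cons by auto
    ultimately show ?thesis
      unfolding Cons pmf_history_Suc by (simp add: Suc)
  qed
qed

lemma distr_observed:
  fixes \<xi> :: "nat \<Rightarrow> 'w \<Rightarrow> 's :: countable"
  assumes mc: "markov_chain K M \<xi>" and pos: "\<P>(\<omega> in M. \<xi> 0 \<omega> = s) > 0"
  shows "distr (uniform_measure M {\<omega> \<in> space M. \<xi> 0 \<omega> = s}) (count_space UNIV) (observed \<xi> t)
    = measure_pmf (history K s t)"
proof (rule measure_eqI_countable[where A = UNIV])
  interpret prob_space M using mc by (simp add: markov_chain_def)
  have meas: "\<xi> t \<in> measurable M (count_space UNIV)" for t using mc by (simp add: markov_chain_def)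
  note [measurable] = meas measurable_observed[OF meas]
  let ?A = "{\<omega> \<in> space M. \<xi> 0 \<omega> = s}"
  fix xs :: "'s list"
  have "emeasure (distr (uniform_measure M ?A) (count_space UNIV) (observed \<xi> t)) {xs}
      = emeasure (uniform_measure M ?A) {\<omega> \<in> space M. observed \<xi> t \<omega> = xs}"
  proof (subst emeasure_distr)
    have "observed \<xi> t -` {xs} \<inter> space (uniform_measure M ?A) = {\<omega> \<in> space M. observed \<xi> t \<omega> = xs}"
      by auto
    then show "emeasure (uniform_measure M ?A) (observed \<xi> t -` {xs} \<inter> space (uniform_measure M ?A))
      = emeasure (uniform_measure M ?A) {\<omega> \<in> space M. observed \<xi> t \<omega> = xs}" by (simp only:)
  qed measurable
  also have "\<dots> = emeasure M (?A \<inter> {\<omega> \<in> space M. observed \<xi> t \<omega> = xs}) / emeasure M ?A"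
    by (rule emeasure_uniform_measure) measurable
  also have "?A \<inter> {\<omega> \<in> space M. observed \<xi> t \<omega> = xs} = {\<omega> \<in> space M. \<xi> 0 \<omega> = s \<and> observed \<xi> t \<omega> = xs}"
    by auto
  also have "emeasure M \<dots> / emeasure M ?A = ennreal (pmf (history K s t) xs)"
    unfolding emeasure_eq_measure prob_observed[OF mc] using pos
    by (subst divide_ennreal) (auto simp: field_simps)
  finally show "emeasure (distr (uniform_measure M ?A) (count_space UNIV) (observed \<xi> t)) {xs}
      = emeasure (measure_pmf (history K s t)) {xs}"
    by (simp add: emeasure_pmf_single)
qed auto

section \<open>Survival away from the ground state\<close>

text \<open>Killing the chain at the ground state does not destroy the submartingale property, since there are
  no inversions to be lost at that moment.\<close>

lemma expected_inversions_on_survival: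
  fixes p \<beta> :: real
  assumes "0 \<le> p" "p < 1 / 2" "0 \<le> \<beta>" "\<beta> \<le> (1 - 2 * p) / (2 - 2 * p)" and c: "c \<noteq> ground_state"
  shows "1 \<le> measure_pmf.expectation (history (step \<beta> p) c t)
    (\<lambda>xs. real (inversion_number (hd xs)) * of_bool (ground_state \<notin> set xs))"
proof (induction t)
  case 0
  then show ?case using c inversion_number_pos[OF c] by simp
next
  case (Suc t)
  let ?h = "\<lambda>xs. real (inversion_number (hd xs)) * of_bool (ground_state \<notin> set xs)"
  let ?H = "history (step \<beta> p) c t"
  note fin = finite_set_pmf_history[OF finite_set_pmf_step]
  have "measure_pmf.expectation (history (step \<beta> p) c (Suc t)) ?h =
      measure_pmf.expectation ?H (\<lambda>xs. measure_pmf.expectation (step \<beta> p (hd xs)) (\<lambda>y. ?h (y # xs)))"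
    using fin finite_set_pmf_step by (simp add: expectation_bind_finite)
  also have "\<dots> \<ge> measure_pmf.expectation ?H ?h"
  proof (rule expectation_mono_finite[OF fin])
    fix xs
    have "(\<lambda>y. ?h (y # xs)) = (\<lambda>y. real (inversion_number y) * of_bool (ground_state \<notin> set xs))"
      by (auto simp: fun_eq_iff inversion_number_ground_state)
    then show "?h xs \<le> measure_pmf.expectation (step \<beta> p (hd xs)) (\<lambda>y. ?h (y # xs))"
      using inversion_number_submartingale[OF assms(1-4), of "hd xs"] by simp
  qed
  finally show ?case using Suc by linarith
qed

lemma truncate_by_power:
  fixes x R :: real
  assumes "0 \<le> x" "0 < R"
  shows "x * of_bool b \<le> R * of_bool b + x ^ Suc j / R ^ j"
proof (cases "x \<le> R")
  case True
  then show ?thesis using assms by (cases b) (auto intro: add_increasing2)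
next
  case False
  then have "R ^ j \<le> x ^ j" using assms by (intro power_mono) auto
  then have "x * R ^ j \<le> x * x ^ j" using assms by (intro mult_left_mono) auto
  then have "x \<le> x ^ Suc j / R ^ j" using assms by (simp add: field_simps)
  then show ?thesis using assms by (cases b) auto
qed

text \<open>Cut the number of inversions at level \<open>R = t ^ (1 + \<delta>)\<close> with \<open>\<delta> = \<epsilon> / 2\<close>. The part below \<open>R\<close>
  contributes at most \<open>R\<close> times the survival probability, hence at most \<open>B t ^ (- \<delta>)\<close>; the part
  above contributes, by the moment of order \<open>j + 1\<close>, at most \<open>C t ^ (j + 1) / R ^ j\<close>. The order
  is chosen such that this is at most \<open>C t ^ (- \<delta>)\<close> as well. But the sum is at
  least 1 for all \<open>t\<close>.\<close>

lemma survival_probability_not_small: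
  fixes p \<beta> :: real
  assumes p: "0 \<le> p" "p < 1 / 2" and \<beta>: "0 \<le> \<beta>" "\<beta> \<le> (1 - 2 * p) / (2 - 2 * p)"
    and c: "c \<noteq> ground_state" and \<epsilon>: "0 < \<epsilon>"
    and B: "\<And>t. real t powr (1 + \<epsilon>) * measure (history (step \<beta> p) c t) {xs. ground_state \<notin> set xs} \<le> B"
  shows False
proof -
  define \<delta> where "\<delta> = \<epsilon> / 2"
  have \<delta>: "0 < \<delta>" using \<epsilon> by (simp add: \<delta>_def)
  define j where "j = nat \<lceil>(1 + \<delta>) / \<delta>\<rceil>"
  have j: "1 + \<delta> \<le> real j * \<delta>"
  proof -
    have "(1 + \<delta>) / \<delta> \<le> real j" unfolding j_def by (rule real_nat_ceiling_ge)
    then show ?thesis using \<delta> by (simp add: field_simps)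
  qed
  have "(1 - 2 * p) / (2 - 2 * p) \<le> 1" using p by (simp add: field_simps)
  then have b1: "\<beta> \<le> 1" using \<beta> by linarith
  from inversion_number_moment[OF \<beta>(1) b1 p(1), of "Suc j" c] p obtain C where C:
    "\<And>t. 1 \<le> t \<Longrightarrow> measure_pmf.expectation (iterate_kernel (step \<beta> p) c t)
      (\<lambda>c. real (inversion_number c) ^ Suc j) \<le> C * real t ^ Suc j" by auto
  have main: "1 \<le> (\<bar>B\<bar> + \<bar>C\<bar>) * real t powr (- \<delta>)" if t: "1 \<le> t" for t
  proof -
    define R where "R = real t powr (1 + \<delta>)"
    have R: "0 < R" using t by (simp add: R_def)
    let ?H = "history (step \<beta> p) c t"
    let ?I = "\<lambda>xs. real (inversion_number (hd xs))"
    let ?b = "\<lambda>xs. of_bool (ground_state \<notin> set xs) :: real"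
    have fin: "finite (set_pmf ?H)" by (intro finite_set_pmf_history finite_set_pmf_step)
    note int = integrable_measure_pmf_finite[OF fin]
    have "1 \<le> measure_pmf.expectation ?H (\<lambda>xs. ?I xs * ?b xs)"
      by (rule expected_inversions_on_survival[OF p \<beta> c])
    also have "\<dots> \<le> measure_pmf.expectation ?H (\<lambda>xs. R * ?b xs + ?I xs ^ Suc j / R ^ j)"
      using R by (intro expectation_mono_finite fin truncate_by_power) auto
    also have "\<dots> = R * measure_pmf.expectation ?H ?b + measure_pmf.expectation ?H (\<lambda>xs. ?I xs ^ Suc j) / R ^ j"
      using int by (subst Bochner_Integration.integral_add) auto
    also have "?b = indicator {xs. ground_state \<notin> set xs}"
      by (auto simp: fun_eq_iff indicator_def)
    also have "measure_pmf.expectation ?H (indicator {xs. ground_state \<notin> set xs})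
        = measure ?H {xs. ground_state \<notin> set xs}" by simp
    also have "measure_pmf.expectation ?H (\<lambda>xs. ?I xs ^ Suc j) =
        measure_pmf.expectation (iterate_kernel (step \<beta> p) c t) (\<lambda>c. real (inversion_number c) ^ Suc j)"
      by (simp flip: map_hd_history)
    also have "R * measure ?H {xs. ground_state \<notin> set xs} \<le> \<bar>B\<bar> * real t powr (- \<delta>)"
    proof -
      have "R = real t powr (- \<delta>) * real t powr (1 + \<epsilon>)"
        unfolding R_def powr_add[symmetric] by (simp add: \<delta>_def add.commute)
      then have "R * measure ?H {xs. ground_state \<notin> set xs} =
          real t powr (- \<delta>) * (real t powr (1 + \<epsilon>) * measure ?H {xs. ground_state \<notin> set xs})"
        by (simp only: mult.assoc)
      also have "\<dots> \<le> real t powr (- \<delta>) * \<bar>B\<bar>"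
        by (intro mult_left_mono order_trans[OF B abs_ge_self]) simp
      finally show ?thesis by (simp only: mult.commute)
    qed
    also have "measure_pmf.expectation (iterate_kernel (step \<beta> p) c t)
        (\<lambda>c. real (inversion_number c) ^ Suc j) / R ^ j \<le> \<bar>C\<bar> * real t powr (- \<delta>)"
    proof -
      have "measure_pmf.expectation (iterate_kernel (step \<beta> p) c t)
        (\<lambda>c. real (inversion_number c) ^ Suc j) / R ^ j \<le> (\<bar>C\<bar> * real t ^ Suc j) / R ^ j"
        using C[OF t] R mult_right_mono[OF abs_ge_self[of C], of "real t ^ Suc j"]
        by (intro divide_right_mono) auto
      also have "\<dots> = \<bar>C\<bar> * (real t powr (real (Suc j)) / real t powr ((1 + \<delta>) * real j))"
      proof -
        have "real t ^ Suc j = real t powr real (Suc j)" using t by (intro powr_realpow[symmetric]) simp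
        moreover have "R ^ j = real t powr ((1 + \<delta>) * real j)"
          using R by (simp only: powr_realpow[symmetric] R_def powr_powr)
        ultimately show ?thesis by (simp only: times_divide_eq_right)
      qed
      also have "\<dots> = \<bar>C\<bar> * real t powr (1 - real j * \<delta>)"
        unfolding powr_diff[symmetric]
        by (rule arg_cong[where f = "\<lambda>e. \<bar>C\<bar> * real t powr e"]) (simp add: algebra_simps)
      also have "\<dots> \<le> \<bar>C\<bar> * real t powr (- \<delta>)"
        using t j by (intro mult_left_mono powr_mono) auto
      finally show ?thesis .
    qed
    finally show ?thesis by (simp add: algebra_simps)
  qed
  have "((\<lambda>t. (\<bar>B\<bar> + \<bar>C\<bar>) * real t powr (- \<delta>)) \<longlongrightarrow> (\<bar>B\<bar> + \<bar>C\<bar>) * 0) sequentially"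
    using \<delta> by (intro tendsto_mult tendsto_const tendsto_neg_powr filterlim_real_sequentially) auto
  then have "eventually (\<lambda>t. (\<bar>B\<bar> + \<bar>C\<bar>) * real t powr (- \<delta>) < 1) sequentially"
    by (rule order_tendstoD) simp
  then have "eventually (\<lambda>t. (\<bar>B\<bar> + \<bar>C\<bar>) * real t powr (- \<delta>) < 1 \<and> 1 \<le> t) sequentially"
    using eventually_ge_at_top eventually_conj by blast
  then obtain t where "(\<bar>B\<bar> + \<bar>C\<bar>) * real t powr (- \<delta>) < 1" "1 \<le> t"
    by (auto dest: eventually_happens)
  then show False using main[of t] by linarith
qed

lemma relaxation_time_ge:
  assumes "ground_state \<notin> X ` {..t}"
  shows "enat t \<le> relaxation_time X"
  unfolding relaxation_time_def
proof (rule Inf_greatest)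
  fix n assume "n \<in> {enat s |s. 1 \<le> s \<and> X s = ground_state}"
  then obtain s where s: "n = enat s" "X s = ground_state" by auto
  then have "\<not> s \<le> t" using assms by (metis atMost_iff imageI)
  then show "enat t \<le> n" using s by simp
qed

lemma enat_powr_mono:
  assumes "enat t \<le> n" "0 \<le> a" shows "ennreal (real t powr a) \<le> enat_powr n a"
  using assms by (cases n) (auto simp: enat_powr_def intro!: ennreal_leI powr_mono2)

text \<open>Markov's inequality for the relaxation time, with the survival event expressed through the law of
  the history.\<close>

lemma survival_le_moment:
  assumes mc: "markov_chain K M \<xi>" and pos: "\<P>(\<omega> in M. \<xi> 0 \<omega> = s) > 0" and a: "0 \<le> a"
  shows "ennreal (real t powr a * measure (history K s t) {xs. ground_state \<notin> set xs})
    \<le> cond_nn_expectation M (\<lambda>\<omega>. enat_powr (relaxation_time (\<lambda>t. \<xi> t \<omega>)) a) (\<lambda>\<omega>. \<xi> 0 \<omega> = s)"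
proof -
  have meas: "\<xi> t \<in> measurable M (count_space UNIV)" for t using mc by (simp add: markov_chain_def)
  note [measurable] = meas measurable_observed[OF meas]
  let ?N = "uniform_measure M {\<omega> \<in> space M. \<xi> 0 \<omega> = s}"
  let ?A = "{\<omega> \<in> space M. ground_state \<notin> set (observed \<xi> t \<omega>)}"
  have A: "?A \<in> sets ?N" by simp
  have "ennreal (real t powr a * measure (history K s t) {xs. ground_state \<notin> set xs})
      = ennreal (real t powr a) * emeasure (measure_pmf (history K s t)) {xs. ground_state \<notin> set xs}"
    by (simp add: ennreal_mult measure_pmf.emeasure_eq_measure)
  also have "emeasure (measure_pmf (history K s t)) {xs. ground_state \<notin> set xs} = emeasure ?N ?A"
    unfolding distr_observed[OF mc pos, symmetric]
  proof (subst emeasure_distr)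
    have "observed \<xi> t -` {xs. ground_state \<notin> set xs} \<inter> space ?N = ?A" by auto
    then show "emeasure ?N (observed \<xi> t -` {xs. ground_state \<notin> set xs} \<inter> space ?N) = emeasure ?N ?A"
      by (simp only:)
  qed measurable
  also have "ennreal (real t powr a) * emeasure ?N ?A = (\<integral>\<^sup>+ \<omega>. ennreal (real t powr a) * indicator ?A \<omega> \<partial>?N)"
    using A by (rule nn_integral_cmult_indicator[symmetric])
  also have "\<dots> \<le> (\<integral>\<^sup>+ \<omega>. enat_powr (relaxation_time (\<lambda>t. \<xi> t \<omega>)) a \<partial>?N)"
    by (intro nn_integral_mono)
      (auto simp: indicator_def set_observed intro!: enat_powr_mono[OF relaxation_time_ge a])
  finally show ?thesis by (simp add: cond_nn_expectation_def)
qed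

theorem theorem2:
  fixes p :: real
  assumes "0 \<le> p" and "p < 1 / 2"
  shows "\<exists>\<beta>\<^sub>1. \<beta>\<^sub>1 = (1 - 2 * p) / (2 - 2 * p) \<and> \<beta>\<^sub>1 \<in> {0<..1 / 2} \<and>
    (\<forall>\<beta>\<in>{0..\<beta>\<^sub>1}. \<forall>\<epsilon>>0. \<forall>S\<^sub>0. S\<^sub>0 \<noteq> ground_state \<longrightarrow>
      (\<forall>(M :: 'w measure) \<xi>.
        exclusion_voter_process \<beta> p M \<xi> \<longrightarrow>
        \<P>(\<omega> in M. \<xi> 0 \<omega> = S\<^sub>0) > 0 \<longrightarrow>
        cond_nn_expectation M (\<lambda>\<omega>. enat_powr (relaxation_time (\<lambda>t. \<xi> t \<omega>)) (1 + \<epsilon>))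
          (\<lambda>\<omega>. \<xi> 0 \<omega> = S\<^sub>0) = \<infinity>))"
proof (intro exI[of _ "(1 - 2 * p) / (2 - 2 * p)"] conjI refl ballI allI impI)
  show "(1 - 2 * p) / (2 - 2 * p) \<in> {0<..1 / 2}"
    using assms by (simp add: field_simps)
  fix \<beta> \<epsilon> :: real and S\<^sub>0 :: config and M :: "'w measure" and \<xi> :: "nat \<Rightarrow> 'w \<Rightarrow> config"
  assume \<beta>: "\<beta> \<in> {0..(1 - 2 * p) / (2 - 2 * p)}" and \<epsilon>: "0 < \<epsilon>" and S\<^sub>0: "S\<^sub>0 \<noteq> ground_state"
    and ev: "exclusion_voter_process \<beta> p M \<xi>" and pos: "\<P>(\<omega> in M. \<xi> 0 \<omega> = S\<^sub>0) > 0"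
  let ?E = "cond_nn_expectation M (\<lambda>\<omega>. enat_powr (relaxation_time (\<lambda>t. \<xi> t \<omega>)) (1 + \<epsilon>)) (\<lambda>\<omega>. \<xi> 0 \<omega> = S\<^sub>0)"
  have mc: "markov_chain (step \<beta> p) M \<xi>" using ev by (simp add: exclusion_voter_process_def)
  show "?E = \<infinity>"
  proof (rule ccontr)
    assume "?E \<noteq> \<infinity>"
    then obtain B where B: "?E = ennreal B" "0 \<le> B" by (cases ?E) auto
    have "real t powr (1 + \<epsilon>) * measure (history (step \<beta> p) S\<^sub>0 t) {xs. ground_state \<notin> set xs} \<le> B" for t
      using survival_le_moment[OF mc pos, of "1 + \<epsilon>" t] \<epsilon> B by (simp add: ennreal_le_iff)
    then show False
      using survival_probability_not_small[OF assms _ _ S\<^sub>0 \<epsilon>] \<beta> by auto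
  qed
qed

end
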